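(* For any graph $G$, the following assertions are equivalent. (a) $G$ is hereditarily equidominating. (b) $G$ is $\mathcal{F}$-free, where $\mathcal{F}=\{P_5,C_5,\mathit{bull},\mathit{banner},\mathit{house},K_{2,3},\overline{P_2\cup P_3}\}$. (c) One of the following holds: (i) $G$ is a basic graph; (ii) $G$ is obtained from a hereditarily equidominating graph by adding a universal vertex; (iii) $G$ is a chain-join of two hereditarily equidominating graphs.
   Context: All graphs are finite, simple and undirected; $\mathbb{N}=\{1,2,\dots\}$. A minimal dominating set (mds) of $G=(V,E)$ is an inclusion-minimal set $D\subseteq V$ such that every vertex is in $D$ or adjacent to a vertex of $D$. $G$ is equidominating if there exist $t\in\mathbb{N}$ and $w\colon V\to\mathbb{N}$ such that for all $D\subseteq V$: $D$ is an mds iff $\sum_{v\in D}w(v)=t$. $G$ is hereditarily equidominating if every induced subgraph of $G$ is equidominating. $G$ is $\mathcal{F}$-free if no induced subgraph of $G$ is isomorphic to a member of $\mathcal{F}$. $P_5$ and $C_5$ are the path and cycle on 5 vertices; the bull is a triangle $abc$ with pendant vertices attached to $a$ and to $b$ (edges $ab,ac,bc,ad,be$); the banner is a 4-cycle with one pendant vertex attached to one cycle vertex; the house is the complement of $P_5$ (a 4-cycle $abcd$ plus a vertex $e$ adjacent to $a$ and $b$); $K_{2,3}$ is the complete bipartite graph; $\overline{P_2\cup P_3}$ is the complement of the disjoint union of a path on 2 and a path on 3 vertices. A universal vertex is adjacent to all other vertices. For $n\ge 2$, $K_{2n}-ne$ is the graph obtained from the complete graph on $2n$ vertices by removing $n$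 pairwise disjoint edges. Basic graphs are $K_1$ and the graphs $K_{2n}-ne$ for $n\ge 2$. A chain graph is a bipartite graph in which the neighborhoods of the vertices of each side are pairwise comparable under inclusion. For disjoint graphs $G_1,G_2$ with $U_i$ the (possibly empty) set of universal vertices of $G_i$, and any chain graph $B$ with bipartition $U_1,U_2$, the graph $(G_1\cup G_2)+E(B)$ (disjoint union plus the edges of $B$) is called a chain-join of $G_1$ and $G_2$. *)

theory Defs
  imports Main
begin

text \<open>An edge is a two-element set of vertices.\<close>

datatype 'a graph = Graph (verts: "'a set") (edges: "'a set set")

definition all_edges :: "'a set \<Rightarrow> 'a set set" where
  "all_edges V = {{u, v} | u v. u \<in> V \<and> v \<in> V \<and> u \<noteq> v}"

text \<open>
  Graphs have at least one vertex. This convention is forced: the only minimal dominating set of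
  the graph without vertices has weight 0, so no positive threshold makes it equidominating.
\<close>

definition graph :: "'a graph \<Rightarrow> bool" where
  "graph G \<longleftrightarrow> finite (verts G) \<and> verts G \<noteq> {} \<and> edges G \<subseteq> all_edges (verts G)"

definition neighbors :: "'a graph \<Rightarrow> 'a \<Rightarrow> 'a set" where
  "neighbors G v = {u. {u, v} \<in> edges G}"

definition induced_subgraph :: "'a graph \<Rightarrow> 'a set \<Rightarrow> 'a graph" where
  "induced_subgraph G W = Graph W {e \<in> edges G. e \<subseteq> W}"

definition complement :: "'a graph \<Rightarrow> 'a graph" where
  "complement G = Graph (verts G) (all_edges (verts G) - edges G)"

definition isomorphic :: "'a graph \<Rightarrow> 'b graph \<Rightarrow> bool" where
  "isomorphic G H \<longleftrightarrow>
     (\<exists>f. bij_betw f (verts G) (verts H) \<and>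
          (\<forall>u\<in>verts G. \<forall>v\<in>verts G. {u, v} \<in> edges G \<longleftrightarrow> {f u, f v} \<in> edges H))"

definition free_of :: "'b graph set \<Rightarrow> 'a graph \<Rightarrow> bool" where
  "free_of \<F> G \<longleftrightarrow>
     \<not> (\<exists>H\<in>\<F>. \<exists>W. W \<subseteq> verts G \<and> isomorphic (induced_subgraph G W) H)"

definition dominating :: "'a graph \<Rightarrow> 'a set \<Rightarrow> bool" where
  "dominating G D \<longleftrightarrow>
     D \<subseteq> verts G \<and> (\<forall>v\<in>verts G. v \<in> D \<or> (\<exists>u\<in>D. u \<in> neighbors G v))"

definition mds :: "'a graph \<Rightarrow> 'a set \<Rightarrow> bool" where
  "mds G D \<longleftrightarrow> dominating G D \<and> (\<forall>D'. D' \<subset> D \<longrightarrow> \<not> dominating G D')"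

definition equidominating :: "'a graph \<Rightarrow> bool" where
  "equidominating G \<longleftrightarrow>
     (\<exists>(t::nat) (w::'a \<Rightarrow> nat). t \<ge> 1 \<and> (\<forall>v\<in>verts G. w v \<ge> 1) \<and>
        (\<forall>D. D \<subseteq> verts G \<longrightarrow> (mds G D \<longleftrightarrow> (\<Sum>v\<in>D. w v) = t)))"

definition hereditarily_equidominating :: "'a graph \<Rightarrow> bool" where
  "hereditarily_equidominating G \<longleftrightarrow>
     (\<forall>W. W \<subseteq> verts G \<and> W \<noteq> {} \<longrightarrow> equidominating (induced_subgraph G W))"

definition path_graph :: "nat \<Rightarrow> nat graph" where
  "path_graph n = Graph {..<n} {{i, i + 1} | i. i + 1 < n}"

definition cycle_graph :: "nat \<Rightarrow> nat graph" where
  "cycle_graph n = Graph {..<n} {{i, (i + 1) mod n} | i. i < n}"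

definition complete_bipartite :: "nat \<Rightarrow> nat \<Rightarrow> nat graph" where
  "complete_bipartite m n = Graph {..<m + n} {{i, j} | i j. i < m \<and> m \<le> j \<and> j < m + n}"

definition bull :: "nat graph" where
  "bull = Graph {..<5} {{0, 1}, {0, 2}, {1, 2}, {0, 3}, {1, 4}}"

definition banner :: "nat graph" where
  "banner = Graph {..<5} {{0, 1}, {1, 2}, {2, 3}, {3, 0}, {0, 4}}"

definition house :: "nat graph" where
  "house = complement (path_graph 5)"

definition P2_union_P3 :: "nat graph" where
  "P2_union_P3 = Graph {..<5} {{0, 1}, {2, 3}, {3, 4}}"

definition forbidden :: "nat graph set" where
  "forbidden = {path_graph 5, cycle_graph 5, bull, banner, house, complete_bipartite 2 3,
                complement P2_union_P3}"

definition complete_graph :: "nat \<Rightarrow> nat graph" where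
  "complete_graph n = Graph {..<n} (all_edges {..<n})"

text \<open>The graph $K_{2n} - ne$; the $n$ removed disjoint edges are the pairs $\{2i, 2i+1\}$.\<close>

definition complete_minus_matching :: "nat \<Rightarrow> nat graph" where
  "complete_minus_matching n =
     Graph {..<2 * n} (all_edges {..<2 * n} - {{2 * i, 2 * i + 1} | i. i < n})"

definition basic :: "'a graph \<Rightarrow> bool" where
  "basic G \<longleftrightarrow>
     isomorphic G (complete_graph 1) \<or> (\<exists>n\<ge>2. isomorphic G (complete_minus_matching n))"

definition universal_vertices :: "'a graph \<Rightarrow> 'a set" where
  "universal_vertices G = {v \<in> verts G. \<forall>u\<in>verts G - {v}. u \<in> neighbors G v}"

definition add_universal :: "'a \<Rightarrow> 'a graph \<Rightarrow> 'a graph" where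
  "add_universal v H = Graph (insert v (verts H)) (edges H \<union> {{u, v} | u. u \<in> verts H})"

text \<open>
  The bipartition is part of the data, and its sides may be empty; in particular, both sets of
  universal vertices in a chain-join may be empty.
\<close>

definition chain_graph :: "'a graph \<Rightarrow> 'a set \<Rightarrow> 'a set \<Rightarrow> bool" where
  "chain_graph B X Y \<longleftrightarrow>
     X \<inter> Y = {} \<and> verts B = X \<union> Y \<and> edges B \<subseteq> {{x, y} | x y. x \<in> X \<and> y \<in> Y} \<and>
     (\<forall>x\<in>X. \<forall>x'\<in>X. neighbors B x \<subseteq> neighbors B x' \<or> neighbors B x' \<subseteq> neighbors B x) \<and>
     (\<forall>y\<in>Y. \<forall>y'\<in>Y. neighbors B y \<subseteq> neighbors B y' \<or> neighbors B y' \<subseteq> neighbors B y)"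

definition chain_join :: "'a graph \<Rightarrow> 'a graph \<Rightarrow> 'a graph \<Rightarrow> bool" where
  "chain_join G1 G2 G \<longleftrightarrow>
     verts G1 \<inter> verts G2 = {} \<and>
     (\<exists>B. chain_graph B (universal_vertices G1) (universal_vertices G2) \<and>
          G = Graph (verts G1 \<union> verts G2) (edges G1 \<union> edges G2 \<union> edges B))"

end

theory Submission imports Defs begin

text \<open>
  None of the seven forbidden graphs is equidominating: the weight equations of the two-element
  minimal dominating sets already force weight \<open>t\<close> on a pair that does not dominate. They also have
  no universal vertex and no chain-join decomposition, and each has a vertex with two
  non-neighbours, so all the graphs in (c) are \<open>F\<close>-free.

  For the structure of an \<open>F\<close>-free graph without universal vertex, the key is a nonempty proper
  vertex set \<open>S\<close> whose outer neighbours \<open>A\<close> form a clique complete to \<open>S\<close>. Forbidding bull, house,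
  banner and \<open>P\<^sub>5\<close> then makes the component, outside \<open>S \<union> A\<close>, of a vertex with no neighbour in \<open>A\<close> one
  side of a chain-join. If there is an induced \<open>C\<^sub>4\<close>, it is homogeneous, and \<open>S\<close> is a maximal
  \<open>K\<^bsub>2n\<^esub> - ne\<close> containing it (or \<open>S\<close> is everything and the graph is basic). Otherwise, \<open>S\<close> is a
  smallest set that is, for some \<open>z\<close>, a union of components of \<open>G - N[z]\<close>.

  Equidomination follows by induction: a universal vertex gets weight \<open>t\<close>, and in a chain-join
  without universal vertex the minimal dominating sets are the unions of those of the two sides,
  whose weights are combined as \<open>w\<^sub>1 + N w\<^sub>2\<close> with \<open>N\<close> large.
\<close>

subsection \<open>Structure of graphs without the forbidden subgraphs\<close>

text \<open>A relation instead of an edge set turns forbidden patterns into plain conditions on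
  adjacencies. With \<open>sym\<close>, \<open>in_V\<close> puts both ends of an edge in
  \<open>V\<close>.\<close>

locale sgraph =
  fixes V :: "'a set" and E :: "'a \<Rightarrow> 'a \<Rightarrow> bool"
  assumes fin: "finite V"
    and sym: "E u v \<Longrightarrow> E v u"
    and irrefl: "\<not> E u u"
    and in_V: "E u v \<Longrightarrow> u \<in> V"

text \<open>The graph on \<open>V\<close> is a chain-join of its subgraphs induced by \<open>V1\<close> and \<open>V2\<close>.\<close>

definition chain_split :: "'a set \<Rightarrow> ('a \<Rightarrow> 'a \<Rightarrow> bool) \<Rightarrow> 'a set \<Rightarrow> 'a set \<Rightarrow> bool" where
  "chain_split V E V1 V2 \<longleftrightarrow>
     V1 \<union> V2 = V \<and> V1 \<inter> V2 = {} \<and> V1 \<noteq> {} \<and> V2 \<noteq> {} \<and>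
     (\<forall>x\<in>V1. \<forall>y\<in>V2. E x y \<longrightarrow> (\<forall>u\<in>V1 - {x}. E x u) \<and> (\<forall>u\<in>V2 - {y}. E y u)) \<and>
     (\<forall>x\<in>V1. \<forall>x'\<in>V1. \<forall>y\<in>V2. \<forall>y'\<in>V2. E x y \<and> E x' y' \<longrightarrow> E x y' \<or> E x' y)"

lemma chain_splitD:
  assumes "chain_split V E V1 V2"
  shows "V1 \<union> V2 = V" "V1 \<inter> V2 = {}" "V1 \<noteq> {}" "V2 \<noteq> {}"
    and "\<And>x y u. x \<in> V1 \<Longrightarrow> y \<in> V2 \<Longrightarrow> E x y \<Longrightarrow> u \<in> V1 - {x} \<Longrightarrow> E x u"
    and "\<And>x y u. x \<in> V1 \<Longrightarrow> y \<in> V2 \<Longrightarrow> E x y \<Longrightarrow> u \<in> V2 - {y} \<Longrightarrow> E y u"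
    and "\<And>x x' y y'. x \<in> V1 \<Longrightarrow> x' \<in> V1 \<Longrightarrow> y \<in> V2 \<Longrightarrow> y' \<in> V2 \<Longrightarrow> E x y \<Longrightarrow> E x' y' \<Longrightarrow>
      E x y' \<or> E x' y"
  using assms unfolding chain_split_def by blast+

text \<open>For finite nonempty \<open>S\<close> and symmetric \<open>E\<close>: \<open>S\<close> induces some \<open>K\<^bsub>2n\<^esub> - ne\<close>.\<close>

definition cocktail_party :: "'a set \<Rightarrow> ('a \<Rightarrow> 'a \<Rightarrow> bool) \<Rightarrow> bool" where
  "cocktail_party S E \<longleftrightarrow> (\<forall>v\<in>S. \<exists>!u. u \<in> S \<and> u \<noteq> v \<and> \<not> E v u)"

text \<open>An inequality is assumed exactly for two vertices with the same neighbours within the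
  pattern; the adjacencies force all other vertices to be distinct.\<close>

locale forbidden_free = sgraph +
  assumes no_P5: "E a b \<Longrightarrow> E b c \<Longrightarrow> E c d \<Longrightarrow> E d e \<Longrightarrow> \<not> E a c \<Longrightarrow> \<not> E a d \<Longrightarrow>
      \<not> E a e \<Longrightarrow> \<not> E b d \<Longrightarrow> \<not> E b e \<Longrightarrow> \<not> E c e \<Longrightarrow> False"
    and no_C5: "E a b \<Longrightarrow> E b c \<Longrightarrow> E c d \<Longrightarrow> E d e \<Longrightarrow> E e a \<Longrightarrow> \<not> E a c \<Longrightarrow> \<not> E a d \<Longrightarrow>
      \<not> E b d \<Longrightarrow> \<not> E b e \<Longrightarrow> \<not> E c e \<Longrightarrow> False"
    and no_bull: "E a b \<Longrightarrow> E a c \<Longrightarrow> E b c \<Longrightarrow> E a d \<Longrightarrow> E b e \<Longrightarrow> \<not> E a e \<Longrightarrow> \<not> E b d \<Longrightarrow>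
      \<not> E c d \<Longrightarrow> \<not> E c e \<Longrightarrow> \<not> E d e \<Longrightarrow> False"
    and no_banner: "E a b \<Longrightarrow> E b c \<Longrightarrow> E c d \<Longrightarrow> E d a \<Longrightarrow> E a e \<Longrightarrow> \<not> E a c \<Longrightarrow> \<not> E b d \<Longrightarrow>
      \<not> E b e \<Longrightarrow> \<not> E c e \<Longrightarrow> \<not> E d e \<Longrightarrow> b \<noteq> d \<Longrightarrow> False"
    and no_house: "E a b \<Longrightarrow> E b c \<Longrightarrow> E c d \<Longrightarrow> E d a \<Longrightarrow> E a e \<Longrightarrow> E b e \<Longrightarrow> \<not> E a c \<Longrightarrow> \<not> E b d \<Longrightarrow>
      \<not> E c e \<Longrightarrow> \<not> E d e \<Longrightarrow> False"
    and no_K23: "E a b \<Longrightarrow> E b c \<Longrightarrow> E c d \<Longrightarrow> E d a \<Longrightarrow> E a e \<Longrightarrow> E c e \<Longrightarrow> \<not> E a c \<Longrightarrow> \<not> E b d \<Longrightarrow>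
      \<not> E b e \<Longrightarrow> \<not> E d e \<Longrightarrow> a \<noteq> c \<Longrightarrow> b \<noteq> d \<Longrightarrow> b \<noteq> e \<Longrightarrow> d \<noteq> e \<Longrightarrow> False"
    and no_co_P2_P3: "E a b \<Longrightarrow> E b c \<Longrightarrow> E c d \<Longrightarrow> E d a \<Longrightarrow> E a e \<Longrightarrow> E b e \<Longrightarrow> E c e \<Longrightarrow>
      \<not> E a c \<Longrightarrow> \<not> E b d \<Longrightarrow> \<not> E d e \<Longrightarrow> a \<noteq> c \<Longrightarrow> False"
begin

text \<open>The outer neighbours \<open>A\<close> of \<open>S\<close> separate it from the rest
  \<open>Z\<close>. Some \<open>r\<close> in \<open>Z\<close> has no neighbour in \<open>A\<close>,
  and its component \<open>C\<close> in \<open>Z\<close> is one side of the split: the ends of every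
  edge leaving \<open>C\<close> turn out to be adjacent to all others on their own sides.\<close>

lemma chain_split_at_clique_cutset:
  assumes S: "S \<subseteq> V" "S \<noteq> {}" "S \<noteq> V"
    and complete: "\<And>s s' x. s \<in> S \<Longrightarrow> s' \<in> S \<Longrightarrow> x \<in> V - S \<Longrightarrow> E s x \<Longrightarrow> E s' x"
    and clique: "\<And>s s' x y. s \<in> S \<Longrightarrow> s' \<in> S \<Longrightarrow> x \<in> V - S \<Longrightarrow> y \<in> V - S \<Longrightarrow> E s x \<Longrightarrow> E s' y \<Longrightarrow> x \<noteq> y \<Longrightarrow> E x y"
    and no_universal: "\<And>v. v \<in> V \<Longrightarrow> \<exists>u\<in>V. u \<noteq> v \<and> \<not> E v u"
  shows "\<exists>V1 V2. chain_split V E V1 V2"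
proof (rule ccontr)
  assume no_split: "\<not> ?thesis"
  \<comment> \<open>A vertex set without outgoing edges gives a chain split with no cross edges, so
    the assumption makes the graph connected.\<close>
  have connected: "\<exists>u\<in>K. \<exists>v\<in>V-K. E u v" if "K \<subseteq> V" "K \<noteq> {}" "K \<noteq> V" for K
  proof (rule ccontr)
    assume "\<not> ?thesis"
    then have "chain_split V E K (V - K)"
      using that unfolding chain_split_def by auto
    then show False using no_split by blast
  qed
  obtain a where a: "a \<in> S" using S by blast
  define A where "A = {x \<in> V - S. E a x}"
  define Z where "Z = V - S - A"
  have SA: "E s x" "E x s" if "s \<in> S" "x \<in> A" for s x
    using that complete[OF a] a sym unfolding A_def by blast+
  have SZ: "\<not> E s z" "\<not> E z s" if "s \<in> S" "z \<in> Z" for s z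
    using that complete[OF _ a] sym unfolding A_def Z_def by blast+
  have AA: "E x y" if "x \<in> A" "y \<in> A" "x \<noteq> y" for x y
    using that clique[OF a a] unfolding A_def by blast
  have V: "V = S \<union> A \<union> Z" "S \<inter> A = {}" "S \<inter> Z = {}" "A \<inter> Z = {}"
    using S unfolding A_def Z_def by auto
  \<comment> \<open>The neighbourhoods in \<open>Z\<close> of the vertices of \<open>A\<close> form
    a chain: two private neighbours would give, with \<open>a\<close>, a house or a bull.\<close>
  have nested: "E x z' \<or> E y z" if "x \<in> A" "y \<in> A" "z \<in> Z" "z' \<in> Z" "E x z" "E y z'" for x y z z'
  proof (rule ccontr)
    assume n: "\<not> (E x z' \<or> E y z)"
    with that have "x \<noteq> y" by blast
    show False
    proof (cases "E z z'")
      case True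
      show False
        by (rule no_house[of x y z' z a])
          (use that n True SA(2)[OF a] SZ(2)[OF a] AA \<open>x \<noteq> y\<close> sym in blast)+
    next
      case False
      show False
        by (rule no_bull[of x y a z z'])
          (use that n False SA(2)[OF a] SZ(1)[OF a] AA \<open>x \<noteq> y\<close> sym in blast)+
    qed
  qed
  have "A \<noteq> {}"
  proof
    assume "A = {}"
    then show False using connected[OF S] SZ V by blast
  qed
  then obtain y0 where y0: "y0 \<in> A" by blast
  have finZ: "finite Z" using fin unfolding Z_def by simp
  \<comment> \<open>As these neighbourhoods are nested, one of maximal size contains all the
    others.\<close>
  define d where "d y = card {z\<in>Z. E y z}" for y
  have d_le: "\<forall>y. y \<in> A \<longrightarrow> d y < Suc (card Z)" using finZ by (auto simp: d_def less_Suc_eq_le intro!: card_mono)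
  obtain x0 where x0: "x0 \<in> A" and d_max: "\<And>y. y \<in> A \<Longrightarrow> d y \<le> d x0"
    using ex_has_greatest_nat[of "\<lambda>y. y \<in> A", OF y0 d_le] by blast
  have x0_max: "E x0 z" if "y \<in> A" "z \<in> Z" "E y z" for y z
  proof (rule ccontr)
    assume n: "\<not> E x0 z"
    have "{z\<in>Z. E x0 z} \<subset> {z\<in>Z. E y z}" using nested[OF x0 that(1)] n that by blast
    then have "d x0 < d y"
      using finZ unfolding d_def by (intro psubset_card_mono) auto
    then show False using d_max[OF that(1)] by simp
  qed
  \<comment> \<open>A non-neighbour of \<open>x0\<close> must lie in \<open>Z\<close>, and by
    maximality of \<open>x0\<close> no vertex of \<open>A\<close> sees it.\<close>
  obtain r where r: "r \<in> V" "r \<noteq> x0" "\<not> E x0 r" using no_universal x0 V by blast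
  then have rZ: "r \<in> Z" using SA AA x0 V by blast
  have rA: "\<not> E y r" "\<not> E r y" if "y \<in> A" for y using x0_max that r rZ sym by blast+
  \<comment> \<open>\<open>C\<close> is the component of \<open>r\<close> in \<open>Z\<close>,
    obtained without paths as the least set closed under adjacency in \<open>Z\<close>.\<close>
  define closed where "closed K \<longleftrightarrow> K \<subseteq> Z \<and> (\<forall>c\<in>K. \<forall>u\<in>Z. E c u \<longrightarrow> u \<in> K)" for K
  define C where "C = \<Inter>{K. r \<in> K \<and> closed K}"
  have Zcl: "closed Z" unfolding closed_def by blast
  have Cmin: "C \<subseteq> K" if "r \<in> K" "closed K" for K
    using that unfolding C_def by blast
  have CZ: "C \<subseteq> Z" using Cmin Zcl rZ by blast
  have rC: "r \<in> C" unfolding C_def by blast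
  have "u \<in> C" if c: "c \<in> C" and u: "u \<in> Z" "E c u" for c u
    unfolding C_def
  proof (intro InterI, elim CollectE conjE)
    fix K assume "r \<in> K" and K: "closed K"
    then have "c \<in> K" using c Cmin by blast
    then show "u \<in> K" using K u unfolding closed_def by blast
  qed
  then have C: "closed C" using CZ unfolding closed_def by blast
  have Cout: "\<not> E c u" "\<not> E u c" if "c \<in> C" "u \<in> Z" "u \<notin> C" for c u
    using C that sym unfolding closed_def by blast+
  \<comment> \<open>Connectedness of \<open>C\<close>: if \<open>T\<close> misses \<open>r\<close>,
    then \<open>C - T\<close> is also closed and contains \<open>r\<close>, so it is all of
    \<open>C\<close>.\<close>
  have Cconn: "T = C" if T: "T \<subseteq> C" "T \<noteq> {}" "closed T" for T
  proof (cases "r \<in> T")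
    case True then show ?thesis using T Cmin by (metis subset_antisym)
  next
    case False
    have "closed (C - T)" using C T sym unfolding closed_def by blast
    then have "C \<subseteq> C - T" using False rC by (intro Cmin) auto
    then show ?thesis using T by blast
  qed
  \<comment> \<open>The condition on the side \<open>C\<close>. The vertex \<open>a\<close> hangs
    off \<open>x\<close> and sees nothing of \<open>C\<close>, which completes each forbidden
    pattern below.\<close>
  have Cuniv: "E n c" if x: "x \<in> A" and n: "n \<in> C" "E x n" and c: "c \<in> C" "n \<noteq> c" for x n c
  proof -
    note aZ = SZ[OF a]
    have f1: "E n q" if "n \<in> C" "E x n" "p \<in> C" "q \<in> C" "\<not> E x q" "E n p" "E p q" for n p q
    proof (rule ccontr)
      assume nq: "\<not> E n q"
      show False
      proof (cases "E x p")
        case True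
        show False by (rule no_bull[of x p n a q])
          (use that True nq x SA[OF a] aZ CZ sym in blast)+
      next
        case False
        show False by (rule no_P5[of a x n p q])
          (use that False nq x SA[OF a] aZ CZ sym in blast)+
      qed
    qed
    have f2: "E n q" if "n \<in> C" "E x n" "q \<in> C" "E x q" "p \<in> C" "\<not> E x p" "E n p" "E p q" "n \<noteq> q" for n p q
    proof (rule ccontr)
      assume nq: "\<not> E n q"
      show False by (rule no_banner[of x n p q a])
          (use that nq x SA[OF a] aZ CZ sym in blast)+
    qed
    have compl: "E n m" if n: "n \<in> C" "E x n" and m: "m \<in> C" "\<not> E x m" for n m
    proof (rule ccontr)
      assume nm: "\<not> E n m"
      \<comment> \<open>\<open>T\<close> collects the vertices missed by both \<open>x\<close> and
        \<open>n\<close>; \<open>T'\<close> adds the neighbours of \<open>x\<close> missed by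
        \<open>n\<close> that touch \<open>T\<close>. By \<open>f1\<close> and \<open>f2\<close>,
        \<open>T'\<close> is closed in \<open>Z\<close>. It contains \<open>m\<close>, hence equals
        \<open>C\<close>, yet it misses \<open>n\<close>.\<close>
      define T where "T = {t \<in> C. \<not> E x t \<and> \<not> E n t}"
      define T' where "T' = T \<union> {u \<in> C. E x u \<and> u \<noteq> n \<and> \<not> E n u \<and> (\<exists>t\<in>T. E u t)}"
      have "u \<in> T'" if t: "t \<in> T'" and u: "u \<in> Z" and tu: "E t u" for t u
      proof -
        have tC: "t \<in> C" using t unfolding T'_def T_def by blast
        have uC: "u \<in> C" using Cout tC u tu by blast
        show ?thesis
        proof (cases "t \<in> T")
          case True
          then have "\<not> E n u" "u \<noteq> n"
            using f1[OF n uC tC] sym[OF tu] unfolding T_def using tu sym by blast+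
          then show ?thesis using True tu uC sym unfolding T'_def T_def by blast
        next
          case False
          then obtain t1 where t1: "t1 \<in> T" "E t t1" and tt: "E x t" "t \<noteq> n" "\<not> E n t"
            using t unfolding T'_def by blast
          have t1': "t1 \<in> C" "\<not> E x t1" "\<not> E n t1" using t1 unfolding T_def by auto
          show ?thesis
          proof (cases "E x u")
            case True
            have "u \<noteq> n" using tu tt sym by blast
            have "E u t1" using f1[OF uC True tC t1'(1,2) sym[OF tu] t1(2)] .
            moreover have "\<not> E n u" using f1[OF n uC t1'(1,2) _ \<open>E u t1\<close>] t1' by blast
            ultimately show ?thesis using t1 uC True \<open>u \<noteq> n\<close> unfolding T'_def by blast
          next
            case False
            have "\<not> E n u" using f2[OF n tC tt(1) uC False] tt sym[OF tu] by blast
            then show ?thesis using uC False unfolding T'_def T_def by blast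
          qed
        qed
      qed
      moreover have "T' \<subseteq> C" unfolding T'_def T_def by blast
      moreover have "m \<in> T'" using m nm unfolding T'_def T_def by blast
      ultimately have "T' = C" using CZ by (intro Cconn) (auto simp: closed_def)
      then show False using n unfolding T'_def T_def by blast
    qed
    show ?thesis
    proof (cases "E x c")
      case True
      show ?thesis
        using f2[OF n c(1) True rC rA(1)[OF x]] compl[OF n rC rA(1)[OF x]]
          compl[OF c(1) True rC rA(1)[OF x]] sym c by blast
    next
      case False
      then show ?thesis using compl n c by blast
    qed
  qed
  \<comment> \<open>The condition on the side \<open>V - C\<close>, where \<open>x\<close> already
    sees \<open>S\<close> and the rest of \<open>A\<close>.\<close>
  have Auniv: "E x w" if x: "x \<in> A" and z: "z \<in> C" "E x z" and w: "w \<in> Z" "w \<notin> C" for x z w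
  proof (rule ccontr)
    assume xw: "\<not> E x w"
    have zr: "z \<noteq> r" using rA x z by blast
    have Ezr: "E z r" using Cuniv[OF x z rC zr] .
    show False
    proof (cases "\<exists>y\<in>A. E y w")
      case True
      then obtain y where y: "y \<in> A" "E y w" by blast
      have "E y z" using nested[OF x y(1) _ w(1) z(2) y(2)] xw z CZ by blast
      moreover have "x \<noteq> y" using xw y by blast
      ultimately show False
        by (intro no_bull[of y z x w r])
          (use x y z w xw AA Ezr rA[OF x] rA[OF y(1)] Cout[OF z(1) w] Cout[OF rC w] sym in blast)+
    next
      case False
      \<comment> \<open>Connectedness gives an edge \<open>w1 w0\<close> leaving \<open>K\<close>.
        Its end \<open>w0\<close> lies in \<open>Z - C\<close> and has a neighbour in
        \<open>A\<close>, so \<open>x0\<close> sees it, and \<open>r z x0 w0 w1\<close> is an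
        induced \<open>P5\<close>.\<close>
      define K where "K = {w \<in> Z - C. \<forall>y\<in>A. \<not> E y w}"
      have "w \<in> K" using False w unfolding K_def by blast
      moreover have "K \<subseteq> V" "K \<noteq> V" using V a unfolding K_def by blast+
      ultimately obtain w1 w0 where w1: "w1 \<in> K" and w0: "w0 \<in> V" "w0 \<notin> K" "E w1 w0"
        using connected[of K] by blast
      have w1': "w1 \<in> Z" "w1 \<notin> C" "\<not> E x0 w1" using w1 x0 unfolding K_def by auto
      have "w0 \<notin> A" using w1 w0 sym unfolding K_def by blast
      moreover have "w0 \<notin> S" using SZ w1' w0 by blast
      ultimately have w0Z: "w0 \<in> Z" using w0 V by blast
      have w0C: "w0 \<notin> C" using Cout w1' w0 by blast
      have "\<exists>y\<in>A. E y w0" using w0Z w0C w0 unfolding K_def by blast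
      then have "E x0 w0" using x0_max w0Z by blast
      moreover have "E x0 z" using x0_max x z CZ by blast
      ultimately show False
        by (intro no_P5[of r z x0 w0 w1])
          (use Ezr rA[OF x0] w1' w0 Cout[OF z(1) w0Z w0C] Cout[OF z(1) w1'(1,2)]
            Cout[OF rC w0Z w0C] Cout[OF rC w1'(1,2)] sym in blast)+
    qed
  qed
  have cross: "x \<in> A" if "x \<in> V - C" "y \<in> C" "E x y" for x y
    using that V SZ Cout CZ by blast
  have "chain_split V E (V - C) C"
    unfolding chain_split_def
  proof (intro conjI ballI impI)
    show "V - C \<union> C = V" using CZ V by blast
    show "(V - C) \<inter> C = {}" by blast
    show "V - C \<noteq> {}" using CZ a V by blast
    show "C \<noteq> {}" using rC by blast
  next
    fix x y u assume xy: "x \<in> V - C" "y \<in> C" "E x y" and u: "u \<in> V - C - {x}"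
    have x: "x \<in> A" using cross[OF xy] .
    show "E x u" using u V SA[OF _ x] AA[OF x] Auniv[OF x xy(2,3)] by blast
  next
    fix x y u assume xy: "x \<in> V - C" "y \<in> C" "E x y" and u: "u \<in> C - {y}"
    show "E y u" using Cuniv[OF cross[OF xy] xy(2,3), of u] u by blast
  next
    fix x x' y y' assume "x \<in> V - C" "x' \<in> V - C" "y \<in> C" "y' \<in> C" "E x y \<and> E x' y'"
    then show "E x y' \<or> E x' y" using nested[of x x' y y'] cross CZ by blast
  qed
  then show False using no_split by blast
qed

text \<open>A smallest union of components of \<open>G - N[z]\<close>, over all centres
  \<open>z\<close>, satisfies the hypotheses of the cutset lemma; any failure produces a smaller
  union, possibly for another centre.\<close>

lemma chain_split_if_no_C4:
  assumes no_C4: "\<And>a b c d. E a b \<Longrightarrow> E b c \<Longrightarrow> E c d \<Longrightarrow> E d a \<Longrightarrow> \<not> E a c \<Longrightarrow> \<not> E b d \<Longrightarrow>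
      a \<noteq> c \<Longrightarrow> b \<noteq> d \<Longrightarrow> False"
    and ne: "V \<noteq> {}"
    and no_universal: "\<And>v. v \<in> V \<Longrightarrow> \<exists>u\<in>V. u \<noteq> v \<and> \<not> E v u"
  shows "\<exists>V1 V2. chain_split V E V1 V2"
proof -
  \<comment> \<open>\<open>P z S\<close>: \<open>S\<close> is a nonempty union of components of
    \<open>G - N[z]\<close>, so its outer neighbours are neighbours of \<open>z\<close>.\<close>
  define P where "P z S \<longleftrightarrow> z \<in> V \<and> S \<subseteq> V \<and> S \<noteq> {} \<and> z \<notin> S \<and> (\<forall>s\<in>S. \<not> E z s) \<and>
    (\<forall>s\<in>S. \<forall>u. E s u \<longrightarrow> u \<in> S \<or> E z u)" for z S
  obtain z0 where z0: "z0 \<in> V" using ne by blast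
  have "P z0 {u\<in>V. u \<noteq> z0 \<and> \<not> E z0 u}"
    using z0 no_universal[OF z0] in_V sym unfolding P_def by blast
  then obtain S where S: "\<exists>z. P z S" and S_min: "\<And>T. \<exists>z. P z T \<Longrightarrow> card S \<le> card T"
    using exists_least_iff[of "\<lambda>n. \<exists>S. card S = n \<and> (\<exists>z. P z S)"]
    by (metis not_le_imp_less)
  obtain z where z: "P z S" using S by blast
  have min: False if "P y T" "T \<subset> S" for y T
  proof -
    have "finite S" using z fin finite_subset unfolding P_def by blast
    then have "card T < card S" using that(2) by (rule psubset_card_mono)
    moreover have "card S \<le> card T" using S_min that(1) by blast
    ultimately show False by simp
  qed
  have zS: "z \<in> V" "S \<subseteq> V" "S \<noteq> {}" "z \<notin> S" and zn: "\<And>s. s \<in> S \<Longrightarrow> \<not> E z s \<and> \<not> E s z"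
    and zc: "\<And>s u. s \<in> S \<Longrightarrow> E s u \<Longrightarrow> u \<notin> S \<Longrightarrow> E z u"
    using z sym unfolding P_def by blast+
  have clique: "E x y" if s: "s \<in> S" "t \<in> S" and x: "x \<in> V - S" "y \<in> V - S" and e: "E s x" "E t y"
    and "x \<noteq> y" for s t x y
  proof (rule ccontr)
    assume xy: "\<not> E x y"
    have zxy: "E z x" "E z y" using zc s x e by blast+
    have disj: "\<not> (E u x \<and> E u y)" if "u \<in> S" for u
      using no_C4[of z x u y] zxy xy zn[OF that] that zS sym \<open>x \<noteq> y\<close> by blast
    have no_edge: "\<not> E u v" if "u \<in> S" "v \<in> S" "E u x" "E v y" for u v
      using no_C5[of z x u v y] zxy xy zn that disj sym by blast
    \<comment> \<open>An edge from \<open>T\<close> to a vertex of \<open>S - T\<close> not seen by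
      \<open>y\<close> would extend \<open>y z x\<close> to an induced \<open>P5\<close>, and
      \<open>no_edge\<close> excludes the others. So \<open>T\<close> is again a union of components
      for \<open>z\<close>; it misses \<open>t\<close>, against minimality.\<close>
    define T where "T = {u \<in> S. E u x}"
    have "P z T" unfolding P_def
    proof (intro conjI ballI allI impI)
      fix u p assume u: "u \<in> T" and up: "E u p"
      show "p \<in> T \<or> E z p"
      proof (rule ccontr)
        assume n: "\<not> (p \<in> T \<or> E z p)"
        have uS: "u \<in> S" "E u x" using u unfolding T_def by auto
        have pS: "p \<in> S" using zc[OF uS(1) up] n by blast
        have px: "\<not> E p x" using n pS unfolding T_def by blast
        have py: "\<not> E p y" using no_edge[OF uS(1) pS uS(2)] up by blast
        show False using no_P5[of y z x u p] zxy xy uS up pS px py zn disj[OF uS(1)] sym by blast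
      qed
    qed (use zS zn s e in \<open>auto simp: T_def\<close>)
    moreover have "T \<subset> S" using disj s e unfolding T_def by blast
    ultimately show False using min by blast
  qed
  have complete: "E s' x" if s: "s \<in> S" "s' \<in> S" and x: "x \<in> V - S" and e: "E s x" for s s' x
  proof (rule ccontr)
    assume n: "\<not> E s' x"
    \<comment> \<open>The centre changes from \<open>z\<close> to \<open>x\<close>, which is why
      \<open>S\<close> is minimal over all centres. By \<open>clique\<close>, the neighbours of
      \<open>T\<close> outside \<open>S\<close> are adjacent to \<open>x\<close>.\<close>
    define T where "T = {u \<in> S. \<not> E u x}"
    have "P x T" unfolding P_def
    proof (intro conjI ballI allI impI)
      fix t u assume t: "t \<in> T" and tu: "E t u"
      show "u \<in> T \<or> E x u"
      proof (cases "u \<in> S")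
        case True then show ?thesis using sym unfolding T_def by blast
      next
        case False
        have "u \<in> V" using tu in_V sym by blast
        moreover have "u \<noteq> x" using tu t unfolding T_def by blast
        ultimately show ?thesis using clique[of s t x u] s x t tu e False unfolding T_def by blast
      qed
    qed (use x zS s n sym in \<open>auto simp: T_def\<close>)
    moreover have "T \<subset> S" using s e unfolding T_def by blast
    ultimately show False using min by blast
  qed
  show ?thesis
    by (rule chain_split_at_clique_cutset[of S])
      (use zS complete clique no_universal in blast)+
qed

text \<open>A vertex that sees only part of an induced 4-cycle gives a banner (one neighbour), a
  house (two consecutive), a \<open>K23\<close> (two opposite) or the complement of the union of
  \<open>P2\<close> and \<open>P3\<close> (three). Rotating the cycle extends the equivalence to all
  four vertices.\<close>

lemma C4_homogeneous:
  assumes C4: "E a b" "E b c" "E c d" "E d a" "\<not> E a c" "\<not> E b d" "a \<noteq> c" "b \<noteq> d"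
    and v: "v \<notin> {a, b, c, d}"
  shows "E v a \<longleftrightarrow> E v b"
proof -
  have s: "E b a" "E c b" "E d c" "E a d" "\<not> E c a" "\<not> E d b" using C4 sym by blast+
  have sv: "E a v \<longleftrightarrow> E v a" "E b v \<longleftrightarrow> E v b" "E c v \<longleftrightarrow> E v c" "E d v \<longleftrightarrow> E v d" using sym by blast+
  have "a \<noteq> v" "b \<noteq> v" "c \<noteq> v" "d \<noteq> v" using v by auto
  then show ?thesis
    using no_banner[of a b c d v] no_banner[of b c d a v] no_banner[of c d a b v] no_banner[of d a b c v]
      no_house[of a b c d v] no_house[of b c d a v] no_house[of c d a b v] no_house[of d a b c v]
      no_K23[of a b c d v] no_K23[of b c d a v]
      no_co_P2_P3[of a b c d v] no_co_P2_P3[of b c d a v] no_co_P2_P3[of c d a b v] no_co_P2_P3[of d a b c v]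
    by (cases "E v a"; cases "E v b"; cases "E v c"; cases "E v d"; simp add: C4 s sv C4(7,8)[symmetric])
qed

text \<open>An induced 4-cycle grows to a maximal cocktail-party set \<open>S\<close>, and the
  cutset lemma applies to \<open>S\<close> unless \<open>S\<close> is everything. The bound 3 keeps
  out two isolated vertices, which satisfy \<open>cocktail_party\<close> but are not basic.\<close>

lemma cocktail_party_or_chain_split:
  assumes ne: "V \<noteq> {}"
    and no_universal: "\<And>v. v \<in> V \<Longrightarrow> \<exists>u\<in>V. u \<noteq> v \<and> \<not> E v u"
  shows "cocktail_party V E \<and> 3 \<le> card V \<or> (\<exists>V1 V2. chain_split V E V1 V2)"
proof (cases "\<exists>a b c d. E a b \<and> E b c \<and> E c d \<and> E d a \<and> \<not> E a c \<and> \<not> E b d \<and> a \<noteq> c \<and> b \<noteq> d")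
  case False
  then have "\<exists>V1 V2. chain_split V E V1 V2"
    using ne no_universal by (intro chain_split_if_no_C4) blast+
  then show ?thesis by blast
next
  case True
  then obtain a b c d where C4: "E a b" "E b c" "E c d" "E d a" "\<not> E a c" "\<not> E b d" "a \<noteq> c" "b \<noteq> d"
    by blast
  have ne4: "a \<noteq> b" "b \<noteq> c" "c \<noteq> d" "d \<noteq> a" using C4 irrefl by blast+
  define \<S> where "\<S> = {S. S \<subseteq> V \<and> {a, b, c, d} \<subseteq> S \<and> cocktail_party S E}"
  have "finite \<S>" using fin unfolding \<S>_def by simp
  moreover have "{a, b, c, d} \<in> \<S>"
    unfolding \<S>_def cocktail_party_def
    using C4 ne4 in_V sym by (auto simp: Ex1_def)
  ultimately obtain S where S: "S \<in> \<S>" and S_max: "\<And>T. T \<in> \<S> \<Longrightarrow> S \<subseteq> T \<Longrightarrow> S = T"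
    using finite_has_maximal[of \<S>] by blast
  have SV: "S \<subseteq> V" and abcd: "a \<in> S" "b \<in> S" "c \<in> S" "d \<in> S" and cp: "cocktail_party S E"
    using S unfolding \<S>_def by auto
  \<comment> \<open>The partner of \<open>v\<close>, its unique non-neighbour in \<open>S\<close>;
    on \<open>S\<close> this is an involution without fixed points.\<close>
  define p where "p v = (THE u. u \<in> S \<and> u \<noteq> v \<and> \<not> E v u)" for v
  have p: "p v \<in> S" "p v \<noteq> v" "\<not> E v (p v)" if "v \<in> S" for v
    using theI'[of "\<lambda>u. u \<in> S \<and> u \<noteq> v \<and> \<not> E v u"] cp that unfolding p_def cocktail_party_def by blast+
  have pu: "u = p v" if "v \<in> S" "u \<in> S" "u \<noteq> v" "\<not> E v u" for u v
    using cp that p[OF that(1)] unfolding cocktail_party_def by blast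
  have pp: "p (p v) = v" if "v \<in> S" for v
    using pu[OF p(1)[OF that] that] p[OF that] sym by metis
  have adj: "E u v" if "u \<in> S" "v \<in> S" "v \<noteq> u" "v \<noteq> p u" for u v using pu that by blast
  \<comment> \<open>Two vertices from different pairs span, with their partners, an induced
    4-cycle.\<close>
  have hom1: "E v s \<longleftrightarrow> E v t" if "v \<notin> S" "s \<in> S" "t \<in> S" "t \<noteq> s" "t \<noteq> p s" for v s t
  proof -
    have ps: "p s \<in> S" "p t \<in> S" using p that by blast+
    have ne: "p t \<noteq> s" "p t \<noteq> p s" using pp that by metis+
    show ?thesis
    proof (rule C4_homogeneous[of s t "p s" "p t"])
      show "E s t" using adj that by blast
      show "E t (p s)" using adj[OF that(3) ps(1)] ne that by auto
      show "E (p s) (p t)" using adj[OF ps] ne that pp by metis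
      show "E (p t) s" using adj[OF that(2) ps(2)] ne sym by metis
      show "v \<notin> {s, t, p s, p t}" using that ps by blast
    qed (use p that in metis)+
  qed
  have hom: "E v t" if v: "v \<notin> S" and s: "s \<in> S" and t: "t \<in> S" and e: "E v s" for v s t
  proof (cases "t = s \<or> t = p s")
    case False then show ?thesis using hom1 that by blast
  next
    case True
    \<comment> \<open>The partners \<open>s\<close> and \<open>p s\<close> are compared through a
      vertex of another pair; the initial 4-cycle supplies one.\<close>
    obtain u where u: "u \<in> S" "u \<noteq> s" "u \<noteq> p s" using abcd ne4 C4 by metis
    have "E v u" using hom1[OF v s u] e by blast
    then have "E v (p s)" using hom1[OF v p(1)[OF s] u(1,3)] u pp[OF s] by metis
    then show ?thesis using True e by blast
  qed
  have complete: "E s' x" if "s \<in> S" "s' \<in> S" "x \<in> V - S" "E s x" for s s' x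
    using hom[of x s s'] that sym by blast
  \<comment> \<open>Two non-adjacent outer neighbours would be complete to \<open>S\<close> and
    could join it as a new pair, against maximality.\<close>
  have clique: "E x y" if s: "s \<in> S" "s' \<in> S" and x: "x \<in> V - S" "y \<in> V - S"
    and e: "E s x" "E s' y" and xy: "x \<noteq> y" for s s' x y
  proof (rule ccontr)
    assume n: "\<not> E x y"
    have "E u x" "E u y" if "u \<in> S" for u
      using complete[OF s(1) that x(1) e(1)] complete[OF s(2) that x(2) e(2)] .
    then have xc: "E u x" "E x u" "E u y" "E y u" if "u \<in> S" for u
      using that by (simp_all add: sym)
    have "cocktail_party (insert x (insert y S)) E"
      unfolding cocktail_party_def
    proof
      fix v assume v: "v \<in> insert x (insert y S)"
      show "\<exists>!u. u \<in> insert x (insert y S) \<and> u \<noteq> v \<and> \<not> E v u"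
      proof (cases "v \<in> S")
        case True
        then show ?thesis
          using p[OF True] xc[OF True] by (intro ex1I[of _ "p v"]) (blast intro: pu[OF True])+
      next
        case False
        then consider "v = x" | "v = y" using v by blast
        then show ?thesis
        proof cases
          case 1
          show ?thesis using n xc xy unfolding 1 by (intro ex1I[of _ y]) blast+
        next
          case 2
          show ?thesis using n xc xy sym unfolding 2 by (intro ex1I[of _ x]) blast+
        qed
      qed
    qed
    then have "insert x (insert y S) \<in> \<S>" using x SV abcd unfolding \<S>_def by auto
    then have "S = insert x (insert y S)" using S_max by blast
    then show False using x by blast
  qed
  show ?thesis
  proof (cases "S = V")
    case True
    have "card {a, b, c} \<le> card V" using True abcd fin by (intro card_mono) auto
    then show ?thesis using True cp ne4 C4 by auto
  next
    case False
    have "\<exists>V1 V2. chain_split V E V1 V2"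
      by (rule chain_split_at_clique_cutset[of S])
        (use SV abcd False complete clique no_universal in blast)+
    then show ?thesis by blast
  qed
qed

lemma forbidden_free_restrict:
  assumes "W \<subseteq> V"
  shows "forbidden_free W (\<lambda>u v. u \<in> W \<and> v \<in> W \<and> E u v)"
  apply unfold_locales
  subgoal using assms fin finite_subset by blast
  subgoal using sym by blast
  subgoal using irrefl by blast
  subgoal by blast
  subgoal for a b c d e using no_P5[of a b c d e] by blast
  subgoal for a b c d e using no_C5[of a b c d e] by blast
  subgoal for a b c d e using no_bull[of a b c d e] by blast
  subgoal for a b c d e using no_banner[of a b c d e] by blast
  subgoal for a b c d e using no_house[of a b c d e] by blast
  subgoal for a b c d e using no_K23[of a b c d e] by blast
  subgoal for a b c d e using no_co_P2_P3[of a b c d e] by blast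
  done

end

text \<open>Removing one non-adjacent pair at a time and giving it the next two numbers makes the
  pairs the fibres of \<open>div 2\<close>.\<close>

lemma cocktail_party_bij:
  assumes "finite S" "cocktail_party S E" and sym: "\<And>u v. E u v \<Longrightarrow> E v u"
  shows "\<exists>n f. bij_betw f S {..<2 * n::nat} \<and>
    (\<forall>u\<in>S. \<forall>v\<in>S. u \<noteq> v \<longrightarrow> (E u v \<longleftrightarrow> f u div 2 \<noteq> f v div 2))"
  using assms(1,2)
proof (induction "card S" arbitrary: S rule: less_induct)
  case less
  show ?case
  proof (cases "S = {}")
    case True
    then show ?thesis by (intro exI[of _ "0::nat"] exI[of _ "\<lambda>_. 0::nat"]) (auto simp: bij_betw_def)
  next
    case False
    then obtain v where v: "v \<in> S" by blast
    then obtain u where u: "u \<in> S" "u \<noteq> v" "\<not> E v u" and vu: "\<And>x. x \<in> S \<Longrightarrow> x \<noteq> v \<Longrightarrow> \<not> E v x \<Longrightarrow> x = u"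
      using less.prems(2) unfolding cocktail_party_def by metis
    have uv: "\<And>x. x \<in> S \<Longrightarrow> x \<noteq> u \<Longrightarrow> \<not> E u x \<Longrightarrow> x = v"
      using less.prems(2) u v sym unfolding cocktail_party_def by metis
    let ?S = "S - {u, v}"
    have "cocktail_party ?S E" unfolding cocktail_party_def
    proof
      fix x assume x: "x \<in> ?S"
      then obtain y where y: "y \<in> S" "y \<noteq> x" "\<not> E x y" and yu: "\<And>z. z \<in> S \<Longrightarrow> z \<noteq> x \<Longrightarrow> \<not> E x z \<Longrightarrow> z = y"
        using less.prems(2) unfolding cocktail_party_def by (metis DiffD1)
      have "y \<noteq> u" "y \<noteq> v" using x y uv vu sym by blast+
      then show "\<exists>!y. y \<in> ?S \<and> y \<noteq> x \<and> \<not> E x y"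
        using y by (intro ex1I[of _ y]) (blast intro: yu)+
    qed
    moreover have "card ?S < card S" using v less.prems(1) by (intro psubset_card_mono) auto
    ultimately obtain n f where bij: "bij_betw f ?S {..<2 * n::nat}"
      and f: "\<forall>x\<in>?S. \<forall>y\<in>?S. x \<noteq> y \<longrightarrow> (E x y \<longleftrightarrow> f x div 2 \<noteq> f y div 2)"
      using less.hyps[of ?S] less.prems(1) by (metis finite_Diff)
    define g where "g = f(v := 2 * n, u := 2 * n + 1)"
    have gS: "g x = f x" "g x < 2 * n" "g x div 2 < n" if "x \<in> ?S" for x
    proof -
      show "g x = f x" using that unfolding g_def by auto
      moreover have "f x < 2 * n" using bij that unfolding bij_betw_def by blast
      ultimately show "g x < 2 * n" by simp
      then show "g x div 2 < n" by auto
    qed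
    have gv: "g v = 2 * n" "g u = 2 * n + 1" using u unfolding g_def by auto
    have "bij_betw g ?S {..<2 * n}" using bij bij_betw_cong[of ?S g f] gS(1) by blast
    moreover have "bij_betw g {u, v} {2 * n, 2 * n + 1}" using u gv unfolding bij_betw_def by auto
    ultimately have "bij_betw g (?S \<union> {u, v}) ({..<2 * n} \<union> {2 * n, 2 * n + 1})"
      by (rule bij_betw_combine) auto
    moreover have "?S \<union> {u, v} = S" using u v by blast
    moreover have "{..<2 * n} \<union> {2 * n, 2 * n + 1} = {..<2 * Suc n}" by auto
    ultimately have "bij_betw g S {..<2 * Suc n}" by simp
    moreover have "E x y \<longleftrightarrow> g x div 2 \<noteq> g y div 2" if x: "x \<in> S" and y: "y \<in> S" and xy: "x \<noteq> y" for x y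
    proof -
      have "E u y" "E y u" "E v y" "E y v" if "y \<in> ?S" for y using that vu uv sym by blast+
      moreover have "\<not> E u v" using u sym by blast
      moreover have "g v div 2 = n" "g u div 2 = n" using gv by auto
      moreover have "x \<in> ?S \<or> x = u \<or> x = v" "y \<in> ?S \<or> y = u \<or> y = v" using x y by auto
      ultimately show ?thesis using u f gS xy by (metis less_irrefl)
    qed
    ultimately show ?thesis by blast
  qed
qed

subsection \<open>Equidomination\<close>

definition adj :: "'a graph \<Rightarrow> 'a \<Rightarrow> 'a \<Rightarrow> bool" where
  "adj G u v \<longleftrightarrow> {u, v} \<in> edges G"

lemma adj_commute: "adj G u v \<longleftrightarrow> adj G v u"
  by (simp add: adj_def insert_commute)

lemma verts_induced [simp]: "verts (induced_subgraph G W) = W"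
  by (simp add: induced_subgraph_def)

lemma adj_induced [simp]: "adj (induced_subgraph G W) u v \<longleftrightarrow> u \<in> W \<and> v \<in> W \<and> adj G u v"
  by (auto simp: adj_def induced_subgraph_def)

lemma adj_induced_restrict: "adj (induced_subgraph G W) = (\<lambda>u v. u \<in> W \<and> v \<in> W \<and> adj G u v)"
  by (intro ext) simp

lemma induced_induced: "W' \<subseteq> W \<Longrightarrow> induced_subgraph (induced_subgraph G W) W' = induced_subgraph G W'"
  by (auto simp: adj_def induced_subgraph_def)

lemma dominating_alt:
  "dominating G D \<longleftrightarrow> D \<subseteq> verts G \<and> (\<forall>v\<in>verts G. v \<in> D \<or> (\<exists>u\<in>D. adj G u v))"
  by (simp add: dominating_def neighbors_def adj_def)

text \<open>\<open>{v}\<close> is the only minimal dominating set through \<open>v\<close>; the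
  others are those of the remaining graph. With weight \<open>t\<close> on \<open>v\<close> and all
  weights positive, a set through \<open>v\<close> reaches \<open>t\<close> only as
  \<open>{v}\<close>.\<close>

lemma equidominating_add_universal:
  assumes fin: "finite (verts G)" and v: "v \<in> verts G" and univ: "\<And>u. u \<in> verts G \<Longrightarrow> u \<noteq> v \<Longrightarrow> adj G v u"
    and ne: "verts G \<noteq> {v}" and equi: "equidominating (induced_subgraph G (verts G - {v}))"
  shows "equidominating G"
proof -
  let ?W = "verts G - {v}" and ?H = "induced_subgraph G (verts G - {v})"
  obtain t w where t: "t \<ge> (1::nat)" and w: "\<And>u. u \<in> ?W \<Longrightarrow> w u \<ge> (1::nat)"
    and tw: "\<And>D. D \<subseteq> ?W \<Longrightarrow> mds ?H D \<longleftrightarrow> (\<Sum>v\<in>D. w v) = t"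
    using equi unfolding equidominating_def by auto
  have ne': "?W \<noteq> {}" using ne v by blast
  have dom_v: "dominating G D" if "v \<in> D" "D \<subseteq> verts G" for D
    using that univ unfolding dominating_alt by blast
  \<comment> \<open>From right to left: a dominating set of the nonempty rest has a member, and any
    member dominates \<open>v\<close>.\<close>
  have dom_H: "dominating G D \<longleftrightarrow> dominating ?H D" if D: "D \<subseteq> ?W" for D
  proof
    assume "dominating G D"
    then show "dominating ?H D" using D unfolding dominating_alt verts_induced adj_induced by blast
  next
    assume d: "dominating ?H D"
    then obtain u where "u \<in> D" using ne' unfolding dominating_alt by auto
    then have "adj G u v" using D univ adj_commute by (metis DiffE insertI1 subsetD)
    then show "dominating G D" using d D \<open>u \<in> D\<close> unfolding dominating_alt by auto
  qed
  define w' where "w' = w(v := t)"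
  have "mds G D \<longleftrightarrow> (\<Sum>v\<in>D. w' v) = t" if D: "D \<subseteq> verts G" for D
  proof (cases "v \<in> D")
    case True
    have finD: "finite D" using D fin finite_subset by blast
    have "(\<Sum>v\<in>D. w' v) = t + (\<Sum>v\<in>D - {v}. w' v)"
      using True finD by (simp add: sum.remove w'_def)
    also have "(\<Sum>v\<in>D - {v}. w' v) = (\<Sum>v\<in>D - {v}. w v)"
      by (intro sum.cong) (auto simp: w'_def)
    finally have "(\<Sum>v\<in>D. w' v) = t \<longleftrightarrow> (\<Sum>v\<in>D - {v}. w v) = 0" by simp
    also have "\<dots> \<longleftrightarrow> D - {v} = {}"
    proof
      assume "(\<Sum>v\<in>D - {v}. w v) = 0"
      then have "w u = 0" if "u \<in> D - {v}" for u using finD that by simp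
      then show "D - {v} = {}" using w D by fastforce
    qed (simp only: sum.empty)
    also have "\<dots> \<longleftrightarrow> mds G D"
    proof
      assume "D - {v} = {}"
      then have "D = {v}" using True by blast
      moreover have "\<not> dominating G {}" using v unfolding dominating_alt by blast
      ultimately show "mds G D" using dom_v v unfolding mds_def by (auto simp: psubset_eq subset_singleton_iff)
    next
      assume "mds G D"
      then have "\<not> {v} \<subset> D" using dom_v[of "{v}"] v unfolding mds_def by blast
      then show "D - {v} = {}" using True by blast
    qed
    finally show ?thesis by blast
  next
    case False
    then have DW: "D \<subseteq> ?W" using D by blast
    have "mds G D \<longleftrightarrow> mds ?H D"
      using dom_H DW unfolding mds_def by (meson psubset_imp_subset subset_trans)
    moreover have "(\<Sum>v\<in>D. w' v) = (\<Sum>v\<in>D. w v)"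
      using False by (intro sum.cong) (auto simp: w'_def)
    ultimately show ?thesis using tw DW by simp
  qed
  moreover have "\<forall>u\<in>verts G. w' u \<ge> 1" using w t by (auto simp: w'_def)
  ultimately show ?thesis using t unfolding equidominating_def by blast
qed

text \<open>Domination is independent on the two parts, hence so is minimality, and the two weight
  conditions are packed into one number in base \<open>N\<close>.\<close>

lemma equidominating_union:
  assumes fin: "finite (verts G)" and V: "verts G = V1 \<union> V2" "V1 \<inter> V2 = {}"
    and dom: "\<And>D. D \<subseteq> verts G \<Longrightarrow> dominating G D \<longleftrightarrow>
      dominating (induced_subgraph G V1) (D \<inter> V1) \<and> dominating (induced_subgraph G V2) (D \<inter> V2)"
    and equi: "equidominating (induced_subgraph G V1)" "equidominating (induced_subgraph G V2)"
  shows "equidominating G"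
proof -
  let ?H1 = "induced_subgraph G V1" and ?H2 = "induced_subgraph G V2"
  obtain t1 w1 where t1: "t1 \<ge> (1::nat)" and w1: "\<And>u. u \<in> V1 \<Longrightarrow> w1 u \<ge> (1::nat)"
    and tw1: "\<And>D. D \<subseteq> V1 \<Longrightarrow> mds ?H1 D \<longleftrightarrow> (\<Sum>v\<in>D. w1 v) = t1"
    using equi(1) unfolding equidominating_def by auto
  obtain t2 w2 where t2: "t2 \<ge> (1::nat)" and w2: "\<And>u. u \<in> V2 \<Longrightarrow> w2 u \<ge> (1::nat)"
    and tw2: "\<And>D. D \<subseteq> V2 \<Longrightarrow> mds ?H2 D \<longleftrightarrow> (\<Sum>v\<in>D. w2 v) = t2"
    using equi(2) unfolding equidominating_def by auto
  have finV: "finite V1" "finite V2" using fin V by auto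
  \<comment> \<open>\<open>N\<close> exceeds \<open>t1\<close> and the \<open>w1\<close>-weight of
    every subset of \<open>V1\<close>, so total weight and threshold can be compared digit by
    digit.\<close>
  define N where "N = 1 + t1 + (\<Sum>v\<in>V1. w1 v)"
  define w where "w v = (if v \<in> V1 then w1 v else N * w2 v)" for v
  have mds: "mds G D \<longleftrightarrow> mds ?H1 (D \<inter> V1) \<and> mds ?H2 (D \<inter> V2)" if D: "D \<subseteq> verts G" for D
  proof
    assume m: "mds G D"
    have "\<not> dominating ?H1 D1" if "D1 \<subset> D \<inter> V1" for D1
    proof
      assume d: "dominating ?H1 D1"
      let ?D = "D1 \<union> (D \<inter> V2)"
      have "?D \<inter> V1 = D1" "?D \<inter> V2 = D \<inter> V2" "?D \<subset> D" using that V by blast+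
      then show False using d m dom[OF D] dom[of ?D] D unfolding mds_def by auto
    qed
    moreover have "\<not> dominating ?H2 D2" if "D2 \<subset> D \<inter> V2" for D2
    proof
      assume d: "dominating ?H2 D2"
      let ?D = "(D \<inter> V1) \<union> D2"
      have "?D \<inter> V2 = D2" "?D \<inter> V1 = D \<inter> V1" "?D \<subset> D" using that V by blast+
      then show False using d m dom[OF D] dom[of ?D] D unfolding mds_def by auto
    qed
    ultimately show "mds ?H1 (D \<inter> V1) \<and> mds ?H2 (D \<inter> V2)"
      using m dom[OF D] unfolding mds_def by blast
  next
    assume m: "mds ?H1 (D \<inter> V1) \<and> mds ?H2 (D \<inter> V2)"
    have "\<not> dominating G D'" if D': "D' \<subset> D" for D'
    proof
      assume "dominating G D'"
      then have "dominating ?H1 (D' \<inter> V1)" "dominating ?H2 (D' \<inter> V2)"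
        using dom[of D'] D D' by blast+
      then have "\<not> D' \<inter> V1 \<subset> D \<inter> V1" "\<not> D' \<inter> V2 \<subset> D \<inter> V2"
        using m unfolding mds_def by blast+
      then show False using D' D V by blast
    qed
    then show "mds G D" using m dom[OF D] unfolding mds_def by blast
  qed
  have split_weight: "r = r' \<and> s = s'" if "r < N" "r' < N" "r + N * s = r' + N * s'" for r r' s s'
  proof -
    have "(r + N * s) div N = s" "(r + N * s) mod N = r" "(r' + N * s') div N = s'" "(r' + N * s') mod N = r'"
      using that(1,2) by simp_all
    then show ?thesis using that(3) by metis
  qed
  have "mds G D \<longleftrightarrow> (\<Sum>v\<in>D. w v) = t1 + N * t2" if D: "D \<subseteq> verts G" for D
  proof -
    let ?s1 = "\<Sum>v\<in>D \<inter> V1. w1 v" and ?s2 = "\<Sum>v\<in>D \<inter> V2. w2 v"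
    have "D = (D \<inter> V1) \<union> (D \<inter> V2)" using D V by blast
    then have "(\<Sum>v\<in>D. w v) = (\<Sum>v\<in>(D \<inter> V1) \<union> (D \<inter> V2). w v)" by simp
    also have "\<dots> = (\<Sum>v\<in>D \<inter> V1. w v) + (\<Sum>v\<in>D \<inter> V2. w v)"
      using finV V by (intro sum.union_disjoint) auto
    also have "(\<Sum>v\<in>D \<inter> V1. w v) = ?s1" by (intro sum.cong) (auto simp: w_def)
    also have "(\<Sum>v\<in>D \<inter> V2. w v) = N * ?s2"
      unfolding sum_distrib_left using V by (intro sum.cong) (auto simp: w_def)
    finally have "(\<Sum>v\<in>D. w v) = ?s1 + N * ?s2" .
    moreover have "?s1 < N"
      using sum_mono2[of V1 "D \<inter> V1" w1] finV unfolding N_def by simp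
    moreover have "t1 < N" unfolding N_def by simp
    ultimately have "(\<Sum>v\<in>D. w v) = t1 + N * t2 \<longleftrightarrow> ?s1 = t1 \<and> ?s2 = t2"
      by (metis split_weight)
    then show ?thesis using mds[OF D] tw1 tw2 by simp
  qed
  moreover have "\<forall>u\<in>verts G. w u \<ge> 1" using w1 w2 V by (auto simp: w_def N_def intro: trans_le_add1)
  moreover have "t1 + N * t2 \<ge> 1" using t1 by simp
  ultimately show ?thesis unfolding equidominating_def by blast
qed

text \<open>Each vertex has just one non-neighbour, so any two vertices dominate while no single one
  does. The minimal dominating sets are the pairs, cut out by unit weights and threshold 2.\<close>

lemma equidominating_cocktail_party:
  assumes fin: "finite (verts G)" and ne: "verts G \<noteq> {}" and cp: "cocktail_party (verts G) (adj G)"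
  shows "equidominating G"
proof -
  have pair: "dominating G D" if D: "D \<subseteq> verts G" "u \<in> D" "v \<in> D" "u \<noteq> v" for D u v
    unfolding dominating_alt
  proof (intro conjI ballI)
    fix x assume "x \<in> verts G"
    then have "x = u \<or> x = v \<or> adj G x u \<or> adj G x v"
      using cp D unfolding cocktail_party_def by (metis subsetD)
    then show "x \<in> D \<or> (\<exists>u\<in>D. adj G u x)" using D adj_commute by metis
  qed (use D in blast)
  have single: "\<not> dominating G {u}" if "u \<in> verts G" for u
    using cp that unfolding dominating_alt cocktail_party_def by auto
  have empty: "\<not> dominating G {}" using ne unfolding dominating_alt by auto
  have "mds G D \<longleftrightarrow> card D = 2" if D: "D \<subseteq> verts G" for D
  proof
    assume m: "mds G D"
    then have "D \<noteq> {}" using empty unfolding mds_def by metis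
    then obtain u where u: "u \<in> D" by blast
    have "D \<noteq> {u}" using m single[of u] u D unfolding mds_def by (metis subsetD)
    then obtain v where v: "v \<in> D" "v \<noteq> u" using u by blast
    have "dominating G {u, v}" using pair[of "{u, v}" u v] u v D by auto
    then have "\<not> {u, v} \<subset> D" using m unfolding mds_def by metis
    then have "D = {u, v}" using u v by blast
    then show "card D = 2" using v by simp
  next
    assume "card D = 2"
    then obtain u v where uv: "D = {u, v}" "u \<noteq> v" by (meson card_2_iff)
    have "D' = {} \<or> D' = {u} \<or> D' = {v}" if "D' \<subset> D" for D' using that uv by blast
    moreover have "\<not> dominating G {u}" "\<not> dominating G {v}" using single D uv by blast+
    moreover have "dominating G D" using pair[OF D, of u v] uv by blast
    ultimately show "mds G D" using empty unfolding mds_def by metis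
  qed
  then show ?thesis unfolding equidominating_def
    by (intro exI[of _ "2::nat"] exI[of _ "\<lambda>_. 1::nat"]) auto
qed

section \<open>Domination in graphs with a chain split\<close>

lemma chain_split_swap:
  assumes "chain_split V E V1 V2" and sym: "\<And>u v. E u v \<Longrightarrow> E v u"
  shows "chain_split V E V2 V1"
proof -
  note V = chain_splitD(1-4)[OF assms(1)] and full = chain_splitD(5,6)[OF assms(1)]
    and chain = chain_splitD(7)[OF assms(1)]
  show ?thesis unfolding chain_split_def
  proof (intro conjI ballI impI)
    fix x y u assume "x \<in> V2" "y \<in> V1" "E x y" "u \<in> V2 - {x}"
    then show "E x u" using full(2)[of y x u] sym by blast
  next
    fix x y u assume "x \<in> V2" "y \<in> V1" "E x y" "u \<in> V1 - {y}"
    then show "E y u" using full(1)[of y x u] sym by blast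
  next
    fix x x' y y' assume "x \<in> V2" "x' \<in> V2" "y \<in> V1" "y' \<in> V1" "E x y \<and> E x' y'"
    then show "E x y' \<or> E x' y" using chain[of y y' x x'] sym by blast
  qed (use V in blast)+
qed

text \<open>If \<open>D\<close> needed help from \<open>V2\<close> to dominate \<open>V1\<close>,
  some vertex of \<open>D\<close> in \<open>V2\<close> would see all of \<open>V1\<close>; having a
  cross edge, it would also see the rest of \<open>V2\<close> and be universal in
  \<open>G\<close>.\<close>

lemma dominating_chain_split_left:
  assumes fin: "finite (verts G)" and split: "chain_split (verts G) (adj G) V1 V2"
    and no_universal: "\<And>v. v \<in> verts G \<Longrightarrow> \<exists>u\<in>verts G. u \<noteq> v \<and> \<not> adj G v u"
    and D: "dominating G D"
  shows "dominating (induced_subgraph G V1) (D \<inter> V1)"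
proof (rule ccontr)
  assume nd: "\<not> ?thesis"
  note V = chain_splitD(1)[OF split, symmetric] chain_splitD(2)[OF split]
    and full = chain_splitD(5,6)[OF split] and chain = chain_splitD(7)[OF split]
  obtain v where v: "v \<in> V1" "v \<notin> D" "\<And>u. u \<in> D \<Longrightarrow> u \<in> V1 \<Longrightarrow> \<not> adj G u v"
    using nd unfolding dominating_alt by auto
  have dom: "D \<subseteq> V1 \<union> V2" "\<And>x. x \<in> V1 \<Longrightarrow> x \<in> D \<or> (\<exists>u\<in>D. adj G x u)"
    using D V unfolding dominating_alt by (auto simp: adj_commute)
  have v': "\<not> adj G v u" if "u \<in> D" "u \<in> V1" for u using v(3)[OF that] by (simp add: adj_commute)
  then obtain y0 where y0: "y0 \<in> D" "y0 \<in> V2" "adj G v y0"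
    using dom v by blast
  \<comment> \<open>The cross edge to \<open>y0\<close> makes \<open>v\<close> adjacent to the rest
    of \<open>V1\<close>, so a member of \<open>D\<close> there would dominate it.\<close>
  have "D \<inter> V1 = {}"
    using full(1)[OF v(1) y0(2,3)] v(1,2) v' by blast
  then have cover: "\<exists>y\<in>D \<inter> V2. adj G x y" if "x \<in> V1" for x
    using dom(1) dom(2)[OF that] that by blast
  \<comment> \<open>By the chain condition, the largest neighbourhood in \<open>V1\<close> of a
    vertex of \<open>D \<inter> V2\<close> contains the others, and together they cover
    \<open>V1\<close>.\<close>
  define d where "d y = card {x\<in>V1. adj G x y}" for y
  have "\<forall>y. y \<in> D \<inter> V2 \<longrightarrow> d y < Suc (card V1)"
    using fin V by (auto simp: d_def less_Suc_eq_le intro!: card_mono)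
  from ex_has_greatest_nat[of "\<lambda>y. y \<in> D \<inter> V2", OF _ this, of y0] y0
  obtain y where y: "y \<in> D \<inter> V2" and y_max: "\<And>y'. y' \<in> D \<inter> V2 \<Longrightarrow> d y' \<le> d y" by blast
  have yV1: "adj G x y" if x: "x \<in> V1" for x
  proof (rule ccontr)
    assume n: "\<not> adj G x y"
    obtain y' where y': "y' \<in> D \<inter> V2" "adj G x y'" using cover[OF x] by blast
    have "{x\<in>V1. adj G x y} \<subset> {x\<in>V1. adj G x y'}"
      using chain[of _ x y y'] x y y' n by blast
    then have "d y < d y'" unfolding d_def using fin V by (intro psubset_card_mono) auto
    then show False using y_max[OF y'(1)] by simp
  qed
  have "\<exists>u\<in>verts G. u \<noteq> y \<and> \<not> adj G y u" using no_universal y V by blast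
  then obtain u where u: "u \<in> verts G" "u \<noteq> y" "\<not> adj G y u" by blast
  then have "u \<notin> V1" using yV1[of u] by (auto simp: adj_commute)
  then show False using full(2)[OF v(1) _ yV1[OF v(1)], of u] y u V by blast
qed

text \<open>Domination decouples into the two sides: one direction holds for any partition, the
  other is \<open>dominating_chain_split_left\<close> applied to both sides.\<close>

lemma equidominating_chain_split:
  assumes fin: "finite (verts G)" and split: "chain_split (verts G) (adj G) V1 V2"
    and no_universal: "\<And>v. v \<in> verts G \<Longrightarrow> \<exists>u\<in>verts G. u \<noteq> v \<and> \<not> adj G v u"
    and equi: "equidominating (induced_subgraph G V1)" "equidominating (induced_subgraph G V2)"
  shows "equidominating G"
proof -
  have V: "verts G = V1 \<union> V2" "V1 \<inter> V2 = {}" using split unfolding chain_split_def by blast+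
  have "chain_split (verts G) (adj G) V2 V1" by (rule chain_split_swap[OF split]) (simp add: adj_commute)
  note left = dominating_chain_split_left[OF fin split no_universal]
    and right = dominating_chain_split_left[OF fin this no_universal]
  have "dominating G D \<longleftrightarrow>
      dominating (induced_subgraph G V1) (D \<inter> V1) \<and> dominating (induced_subgraph G V2) (D \<inter> V2)"
    if "D \<subseteq> verts G" for D
  proof
    assume "dominating (induced_subgraph G V1) (D \<inter> V1) \<and> dominating (induced_subgraph G V2) (D \<inter> V2)"
    then show "dominating G D" using that V unfolding dominating_alt by auto
  qed (use left right in blast)
  then show ?thesis using equidominating_union[OF fin V] equi by blast
qed

lemma equidominating_if_forbidden_free:
  assumes "forbidden_free (verts G) (adj G)" "verts G \<noteq> {}"
  shows "equidominating G"
  using assms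
proof (induction "card (verts G)" arbitrary: G rule: less_induct)
  case less
  interpret forbidden_free "verts G" "adj G" by fact
  have IH: "equidominating (induced_subgraph G W)" if W: "W \<subset> verts G" "W \<noteq> {}" for W
  proof (rule less.hyps)
    show "card (verts (induced_subgraph G W)) < card (verts G)"
      using W fin by (simp add: psubset_card_mono)
    show "forbidden_free (verts (induced_subgraph G W)) (adj (induced_subgraph G W))"
      using forbidden_free_restrict[of W] W by (simp add: adj_induced_restrict)
    show "verts (induced_subgraph G W) \<noteq> {}" using W by simp
  qed
  show ?case
  proof (cases "\<exists>v\<in>verts G. \<forall>u\<in>verts G. u \<noteq> v \<longrightarrow> adj G v u")
    case True
    then obtain v where v: "v \<in> verts G" "\<And>u. u \<in> verts G \<Longrightarrow> u \<noteq> v \<Longrightarrow> adj G v u" by blast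
    show ?thesis
    proof (cases "verts G = {v}")
      case True
      have "mds G D \<longleftrightarrow> (\<Sum>v\<in>D. 1) = (1::nat)" if "D \<subseteq> verts G" for D
      proof -
        have "D = {} \<or> D = {v}" using that True by (simp add: subset_singleton_iff)
        moreover have "\<not> dominating G {}" "dominating G {v}" unfolding dominating_alt True by auto
        ultimately show ?thesis unfolding mds_def by (auto simp: psubset_eq subset_singleton_iff)
      qed
      then show ?thesis unfolding equidominating_def
        by (intro exI[of _ "1::nat"] exI[of _ "\<lambda>_. 1::nat"]) auto
    next
      case False
      then show ?thesis
        using v by (intro equidominating_add_universal[OF fin v] IH) auto
    qed
  next
    case False
    then have nu: "\<And>v. v \<in> verts G \<Longrightarrow> \<exists>u\<in>verts G. u \<noteq> v \<and> \<not> adj G v u" by blast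
    have "cocktail_party (verts G) (adj G) \<and> 3 \<le> card (verts G) \<or> (\<exists>V1 V2. chain_split (verts G) (adj G) V1 V2)"
      by (rule cocktail_party_or_chain_split) (use less.prems nu in blast)+
    then show ?thesis
    proof (elim disjE exE)
      fix V1 V2 assume s: "chain_split (verts G) (adj G) V1 V2"
      then have "V1 \<subset> verts G" "V1 \<noteq> {}" "V2 \<subset> verts G" "V2 \<noteq> {}" unfolding chain_split_def by auto
      then show ?thesis using equidominating_chain_split[OF fin s nu] IH by blast
    qed (use equidominating_cocktail_party fin less.prems in blast)
  qed
qed

subsection \<open>Induced copies of the forbidden graphs\<close>

definition embeds :: "'b graph \<Rightarrow> 'a graph \<Rightarrow> ('b \<Rightarrow> 'a) \<Rightarrow> bool" where
  "embeds H G g \<longleftrightarrow> inj_on g (verts H) \<and> g ` verts H \<subseteq> verts G \<and>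
     (\<forall>i\<in>verts H. \<forall>j\<in>verts H. adj H i j \<longleftrightarrow> adj G (g i) (g j))"

text \<open>Reading the isomorphism backwards lets the vertices of a copy be addressed by the
  numbers of the forbidden graph.\<close>

lemma free_of_iff_no_embedding:
  fixes \<F> :: "'b graph set"
  shows "free_of \<F> G \<longleftrightarrow> \<not> (\<exists>H\<in>\<F>. \<exists>g. embeds H G g)"
proof -
  have "(\<exists>W. W \<subseteq> verts G \<and> isomorphic (induced_subgraph G W) H) \<longleftrightarrow> (\<exists>g. embeds H G g)" for H :: "'b graph"
  proof
    assume "\<exists>W. W \<subseteq> verts G \<and> isomorphic (induced_subgraph G W) H"
    then obtain W f where W: "W \<subseteq> verts G" and f: "bij_betw f W (verts H)"
      and adj: "\<And>u v. u \<in> W \<Longrightarrow> v \<in> W \<Longrightarrow> adj G u v \<longleftrightarrow> adj H (f u) (f v)"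
      unfolding isomorphic_def by (auto simp flip: adj_def)
    let ?g = "inv_into W f"
    have bij: "bij_betw ?g (verts H) W" using bij_betw_inv_into[OF f] .
    have "f (?g i) = i" "?g i \<in> W" if "i \<in> verts H" for i
      using bij_betw_inv_into_right[OF f that] bij_betwE[OF bij] that by blast+
    then have "embeds H G ?g"
      using bij W adj unfolding embeds_def bij_betw_def by auto
    then show "\<exists>g. embeds H G g" by blast
  next
    assume "\<exists>g. embeds H G g"
    then obtain g where g: "embeds H G g" by blast
    let ?W = "g ` verts H"
    have bij: "bij_betw g (verts H) ?W" using g unfolding embeds_def by (simp add: inj_on_imp_bij_betw)
    have "adj G u v \<longleftrightarrow> adj H (inv_into (verts H) g u) (inv_into (verts H) g v)"
      if "u \<in> ?W" "v \<in> ?W" for u v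
      using g that unfolding embeds_def by (auto simp: inv_into_f_f)
    then have "isomorphic (induced_subgraph G ?W) H"
      using bij_betw_inv_into[OF bij] unfolding isomorphic_def by (auto simp flip: adj_def)
    moreover have "?W \<subseteq> verts G" using g unfolding embeds_def by blast
    ultimately show "\<exists>W. W \<subseteq> verts G \<and> isomorphic (induced_subgraph G W) H" by blast
  qed
  then show ?thesis by (simp only: free_of_def)
qed

section \<open>Adjacency in the seven forbidden graphs\<close>

lemma lessThan_5: "{..<5::nat} = {0, 1, 2, 3, 4}"
  by auto

lemma adj_complement:
  "adj (complement G) u v \<longleftrightarrow> u \<in> verts G \<and> v \<in> verts G \<and> u \<noteq> v \<and> \<not> adj G u v"
  by (auto simp: complement_def all_edges_def doubleton_eq_iff adj_def)

lemma adj_path: "adj (path_graph n) i j \<longleftrightarrow> j = i + 1 \<and> j < n \<or> i = j + 1 \<and> i < n"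
  by (auto simp: path_graph_def doubleton_eq_iff adj_def)

lemma adj_cycle: "adj (cycle_graph n) i j \<longleftrightarrow> i < n \<and> j = (i + 1) mod n \<or> j < n \<and> i = (j + 1) mod n"
  by (auto simp: cycle_graph_def doubleton_eq_iff adj_def)

lemma adj_complete_bipartite:
  "adj (complete_bipartite m n) i j \<longleftrightarrow> i < m \<and> m \<le> j \<and> j < m + n \<or> j < m \<and> m \<le> i \<and> i < m + n"
  by (auto simp: complete_bipartite_def doubleton_eq_iff adj_def)

lemma adj_bull: "adj bull i j \<longleftrightarrow> (i, j) \<in> {(0, 1), (0, 2), (1, 2), (0, 3), (1, 4), (1, 0), (2, 0), (2, 1), (3, 0), (4, 1)}"
  by (auto simp: bull_def doubleton_eq_iff adj_def)

lemma adj_banner: "adj banner i j \<longleftrightarrow> (i, j) \<in> {(0, 1), (1, 2), (2, 3), (3, 0), (0, 4), (1, 0), (2, 1), (3, 2), (0, 3), (4, 0)}"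
  by (auto simp: banner_def doubleton_eq_iff adj_def)

lemma adj_P2_union_P3: "adj P2_union_P3 i j \<longleftrightarrow> (i, j) \<in> {(0, 1), (2, 3), (3, 4), (1, 0), (3, 2), (4, 3)}"
  by (auto simp: P2_union_P3_def doubleton_eq_iff adj_def)

lemma verts_named:
  "verts (path_graph n) = {..<n}" "verts (cycle_graph n) = {..<n}" "verts bull = {..<5}"
  "verts banner = {..<5}" "verts (complete_bipartite k m) = {..<k + m}" "verts P2_union_P3 = {..<5}"
  "verts (complement G) = verts G"
  by (simp_all add: path_graph_def cycle_graph_def bull_def banner_def complete_bipartite_def
      P2_union_P3_def complement_def)

lemmas adj_named = adj_complement adj_path adj_cycle adj_complete_bipartite adj_bull adj_banner
  adj_P2_union_P3 verts_named house_def

lemma verts_forbidden: "H \<in> forbidden \<Longrightarrow> verts H = {..<5}"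
  unfolding forbidden_def by (auto simp: verts_named house_def)

lemma forbidden_cases:
  assumes "H \<in> forbidden"
  obtains "H = path_graph 5" | "H = cycle_graph 5" | "H = bull" | "H = banner" | "H = house"
    | "H = complete_bipartite 2 3" | "H = complement P2_union_P3"
  using assms unfolding forbidden_def by blast

text \<open>Separates the forbidden graphs from the basic ones, where each vertex has at most one
  non-neighbour.\<close>

lemma forbidden_two_nonneighbors:
  assumes "H \<in> forbidden"
  shows "\<exists>i\<in>verts H. \<exists>j\<in>verts H. \<exists>k\<in>verts H. i \<noteq> j \<and> i \<noteq> k \<and> j \<noteq> k \<and> \<not> adj H i j \<and> \<not> adj H i k"
  using assms
  by (cases rule: forbidden_cases) (simp_all add: adj_named lessThan_5)

text \<open>Serves twice: a dominating pair in a forbidden graph is automatically minimal, and a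
  universal vertex of a graph cannot belong to a forbidden copy.\<close>

lemma forbidden_no_universal:
  assumes "H \<in> forbidden"
  shows "\<forall>c\<in>verts H. \<exists>k\<in>verts H. k \<noteq> c \<and> \<not> adj H c k"
  using assms
  by (cases rule: forbidden_cases) (simp_all add: adj_named lessThan_5)

text \<open>No single vertex dominates the copy, so a two-element set is a minimal dominating set as
  soon as it dominates. Equidomination thus becomes equations and disequations on sums of two
  weights.\<close>

lemma embedding_weights:
  assumes g: "embeds H G g" and ne: "verts H \<noteq> {}" and equi: "hereditarily_equidominating G"
    and nu: "\<And>c. c \<in> verts H \<Longrightarrow> \<exists>k\<in>verts H. k \<noteq> c \<and> \<not> adj H c k"
  obtains t w where "\<And>a b. a \<in> verts H \<Longrightarrow> b \<in> verts H \<Longrightarrow> a \<noteq> b \<Longrightarrow>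
    (\<forall>k\<in>verts H. k = a \<or> k = b \<or> adj H a k \<or> adj H b k) \<longleftrightarrow> w a + w b = (t::nat)"
proof -
  let ?W = "g ` verts H"
  let ?K = "induced_subgraph G ?W"
  have inj: "g i = g j \<longleftrightarrow> i = j" if "i \<in> verts H" "j \<in> verts H" for i j
    using g that unfolding embeds_def inj_on_def by blast
  have adj: "adj G (g i) (g j) \<longleftrightarrow> adj H i j" if "i \<in> verts H" "j \<in> verts H" for i j
    using g that unfolding embeds_def by blast
  have "equidominating ?K"
    using equi g ne unfolding hereditarily_equidominating_def embeds_def by blast
  then obtain t w where tw: "\<And>D. D \<subseteq> ?W \<Longrightarrow> mds ?K D \<longleftrightarrow> (\<Sum>v\<in>D. w v) = (t::nat)"
    unfolding equidominating_def by auto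
  have single: "\<not> dominating ?K {g c}" if "c \<in> verts H" for c
    using nu[OF that] inj adj that unfolding dominating_alt by auto
  have empty: "\<not> dominating ?K {}" using ne unfolding dominating_alt by auto
  have "(\<forall>k\<in>verts H. k = a \<or> k = b \<or> adj H a k \<or> adj H b k) \<longleftrightarrow> w (g a) + w (g b) = t"
    if ab: "a \<in> verts H" "b \<in> verts H" "a \<noteq> b" for a b
  proof -
    have "(\<forall>k\<in>verts H. k = a \<or> k = b \<or> adj H a k \<or> adj H b k) \<longleftrightarrow> dominating ?K {g a, g b}"
      using ab unfolding dominating_alt by (auto simp: inj adj)
    also have "\<dots> \<longleftrightarrow> mds ?K {g a, g b}"
    proof -
      have "D = {} \<or> D = {g a} \<or> D = {g b}" if "D \<subset> {g a, g b}" for D using that by blast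
      then show ?thesis using single ab empty unfolding mds_def by metis
    qed
    also have "\<dots> \<longleftrightarrow> (\<Sum>v\<in>{g a, g b}. w v) = t"
      using ab by (intro tw) blast
    also have "(\<Sum>v\<in>{g a, g b}. w v) = w (g a) + w (g b)" using inj ab by simp
    finally show ?thesis .
  qed
  then show ?thesis using that[of "\<lambda>a. w (g a)"] by blast
qed

lemma hereditarily_equidominating_imp_free:
  assumes equi: "hereditarily_equidominating G"
  shows "free_of forbidden G"
  unfolding free_of_iff_no_embedding
proof (rule notI, elim bexE exE)
  fix H g assume H: "H \<in> forbidden" and g: "embeds H G g"
  obtain t w where tw: "\<And>a b. a \<in> verts H \<Longrightarrow> b \<in> verts H \<Longrightarrow> a \<noteq> b \<Longrightarrow>
    (\<forall>k\<in>verts H. k = a \<or> k = b \<or> adj H a k \<or> adj H b k) \<longleftrightarrow> w a + w b = (t::nat)"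
    by (rule embedding_weights[OF g _ equi])
      (use forbidden_no_universal[OF H] verts_forbidden[OF H] lessThan_5 in blast)+
  \<comment> \<open>The ten conditions are contradictory linear arithmetic. For \<open>P5\<close>,
    the pairs \<open>{0, 3}\<close>, \<open>{1, 3}\<close> and \<open>{1, 4}\<close> dominate, so
    \<open>w 0 = w 1\<close> and \<open>w 3 = w 4\<close>; then \<open>{0, 4}\<close> also has
    weight \<open>t\<close>, but it does not dominate the vertex 2.\<close>
  note pairs = tw[of 0 1] tw[of 0 2] tw[of 0 3] tw[of 0 4] tw[of 1 2] tw[of 1 3] tw[of 1 4]
    tw[of 2 3] tw[of 2 4] tw[of 3 4]
  from H show False
  proof (cases rule: forbidden_cases)
    case 1 show ?thesis using pairs unfolding 1 by (simp add: adj_named lessThan_5)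
  next
    case 2 show ?thesis using pairs unfolding 2 by (simp add: adj_named lessThan_5)
  next
    case 3 show ?thesis using pairs unfolding 3 by (simp add: adj_named lessThan_5)
  next
    case 4 show ?thesis using pairs unfolding 4 by (simp add: adj_named lessThan_5)
  next
    case 5 show ?thesis using pairs unfolding 5 by (simp add: adj_named lessThan_5)
  next
    case 6 show ?thesis using pairs unfolding 6 by (simp add: adj_named lessThan_5)
  next
    case 7 show ?thesis using pairs unfolding 7 by (simp add: adj_named lessThan_5)
  qed
qed

text \<open>The end of a cross edge sees its whole side, so all its non-neighbours lie on the other
  side. Following this rule, with the chain condition for two of the graphs, leaves no partition
  into two nonempty sides.\<close>

lemma forbidden_no_chain_split:
  assumes H: "H \<in> forbidden"
  shows "\<not> chain_split (verts H) (adj H) V1 V2"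
proof
  assume s: "chain_split (verts H) (adj H) V1 V2"
  note V = chain_splitD(1-4)[OF s]
  from V have V2: "V2 = verts H - V1" and V1: "V1 \<subseteq> verts H" "V1 \<noteq> {}" "\<not> verts H \<subseteq> V1"
    by blast+
  note full = chain_splitD(5,6)[OF s, unfolded V2] and chain = chain_splitD(7)[OF s, unfolded V2]
  have side: "u \<in> V1 \<longleftrightarrow> y \<in> V1"
    if "adj H x y" "\<not> adj H x u" "u \<noteq> x" "x \<in> V1 \<longleftrightarrow> y \<notin> V1"
      "x \<in> verts H" "y \<in> verts H" "u \<in> verts H" for x y u
    using full(1)[of x y u] full(2)[of y x u] that adj_commute[of H x y] by auto
  \<comment> \<open>The chain condition contraposed: two edges that form an induced matching between
    the sides cannot be cross edges.\<close>
  have no_matching: "x \<in> V1 \<longleftrightarrow> y \<in> V1"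
    if "adj H x y" "adj H x' y'" "\<not> adj H x y'" "\<not> adj H x' y" "x \<in> V1 \<longleftrightarrow> x' \<in> V1" "y \<in> V1 \<longleftrightarrow> y' \<in> V1"
      "x \<in> verts H" "y \<in> verts H" "x' \<in> verts H" "y' \<in> verts H" for x y x' y'
    using chain[of x x' y y'] chain[of y y' x x'] that
      adj_commute[of H x y] adj_commute[of H x' y] adj_commute[of H x y'] adj_commute[of H x' y'] by auto
  have nontrivial: "0 \<in> V1 \<or> 1 \<in> V1 \<or> 2 \<in> V1 \<or> 3 \<in> V1 \<or> 4 \<in> V1"
    "\<not> (0 \<in> V1 \<and> 1 \<in> V1 \<and> 2 \<in> V1 \<and> 3 \<in> V1 \<and> 4 \<in> V1)"
    using V1 unfolding verts_forbidden[OF H] lessThan_5 by auto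
  from H show False
  proof (cases rule: forbidden_cases)
    case 1
    show ?thesis
      using nontrivial
        side[of 0 1 3] side[of 1 0 3] side[of 1 2 4] side[of 2 1 4] side[of 2 3 0] side[of 3 2 0]
        side[of 3 4 0] side[of 4 3 0]
      unfolding 1 by (simp (no_asm_use) add: adj_named) argo
  next
    case 2
    show ?thesis
      using nontrivial
        side[of 0 1 3] side[of 1 0 3] side[of 1 2 4] side[of 2 1 4] side[of 2 3 0] side[of 3 2 0]
        side[of 3 4 1] side[of 4 3 1]
      unfolding 2 by (simp (no_asm_use) add: adj_named) argo
  next
    case 3
    show ?thesis
      using nontrivial
        side[of 0 2 4] side[of 2 0 4] side[of 1 2 3] side[of 2 1 3] side[of 0 3 4] side[of 3 0 4]
        side[of 1 4 3] side[of 4 1 3]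
      unfolding 3 by (simp (no_asm_use) add: adj_named) argo
  next
    case 4
    show ?thesis
      using nontrivial
        side[of 1 2 4] side[of 2 1 4] side[of 2 3 4] side[of 3 2 4] side[of 0 4 2] side[of 4 0 2]
        side[of 1 0 3]
      unfolding 4 by (simp (no_asm_use) add: adj_named) argo
  next
    \<comment> \<open>The triangle \<open>{0, 2, 4}\<close> against the edge \<open>{1, 3}\<close>
      satisfies the universality conditions; the chain condition rejects it.\<close>
    case 5
    show ?thesis
      using nontrivial
        side[of 0 2 1] side[of 2 0 1] side[of 1 3 2] side[of 3 1 2] side[of 2 4 3] side[of 4 2 3]
        no_matching[of 0 3 4 1]
      unfolding 5 by (simp (no_asm_use) add: adj_named) argo
  next
    case 6
    show ?thesis
      using nontrivial
        side[of 0 2 1] side[of 0 3 1] side[of 0 4 1] side[of 1 2 0] side[of 1 3 0] side[of 1 4 0]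
        side[of 2 0 3] side[of 2 0 4] side[of 3 0 2] side[of 3 0 4] side[of 4 0 2] side[of 4 0 3]
        side[of 2 1 3] side[of 2 1 4] side[of 3 1 2] side[of 3 1 4] side[of 4 1 2] side[of 4 1 3]
      unfolding 6 by (simp (no_asm_use) add: adj_named) argo
  next
    \<comment> \<open>Likewise \<open>{0, 3}\<close> against \<open>{1, 2, 4}\<close>, and its
      mirror image \<open>{1, 3}\<close> against \<open>{0, 2, 4}\<close>, fail only the chain
      condition.\<close>
    case 7
    show ?thesis
      using nontrivial
        side[of 2 4 3] side[of 4 2 3] side[of 0 2 1] side[of 2 0 3] side[of 1 2 0] side[of 2 1 3]
        side[of 0 3 1] no_matching[of 0 2 3 1] no_matching[of 1 2 3 0]
      unfolding 7 by (simp (no_asm_use) add: adj_named) argo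
  qed
qed

section \<open>From freeness to the axioms of \<open>forbidden_free\<close>\<close>

lemma adj_irrefl: "graph G \<Longrightarrow> \<not> adj G u u"
  by (auto simp: graph_def adj_def all_edges_def)

lemma adj_in_verts: "graph G \<Longrightarrow> adj G u v \<Longrightarrow> u \<in> verts G"
  by (auto simp: graph_def adj_def all_edges_def doubleton_eq_iff)

text \<open>Ten adjacency values determine an embedding that lists five vertices; symmetry and
  irreflexivity settle the remaining index pairs.\<close>

lemma embeds_nth:
  assumes H: "verts H = {..<5}" "\<And>i. \<not> adj H i i" and G: "graph G"
    and abcde: "distinct [a, b, c, d, e]" "{a, b, c, d, e} \<subseteq> verts G"
    and adj: "adj H 0 1 \<longleftrightarrow> adj G a b" "adj H 0 2 \<longleftrightarrow> adj G a c" "adj H 0 3 \<longleftrightarrow> adj G a d" "adj H 0 4 \<longleftrightarrow> adj G a e"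
      "adj H 1 2 \<longleftrightarrow> adj G b c" "adj H 1 3 \<longleftrightarrow> adj G b d" "adj H 1 4 \<longleftrightarrow> adj G b e"
      "adj H 2 3 \<longleftrightarrow> adj G c d" "adj H 2 4 \<longleftrightarrow> adj G c e" "adj H 3 4 \<longleftrightarrow> adj G d e"
  shows "embeds H G (\<lambda>i. [a, b, c, d, e] ! i)"
proof -
  have less: "adj H i j \<longleftrightarrow> adj G ([a, b, c, d, e] ! i) ([a, b, c, d, e] ! j)" if "i < j" "j < 5" for i j
  proof -
    have "i = 0 \<and> j = 1 \<or> i = 0 \<and> j = 2 \<or> i = 0 \<and> j = 3 \<or> i = 0 \<and> j = 4 \<or> i = 1 \<and> j = 2 \<or>
      i = 1 \<and> j = 3 \<or> i = 1 \<and> j = 4 \<or> i = 2 \<and> j = 3 \<or> i = 2 \<and> j = 4 \<or> i = 3 \<and> j = 4"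
      using that by presburger
    then show ?thesis using adj by (elim disjE conjE) simp_all
  qed
  have "adj H i j \<longleftrightarrow> adj G ([a, b, c, d, e] ! i) ([a, b, c, d, e] ! j)" if "i < 5" "j < 5" for i j
  proof -
    consider "i < j" | "i = j" | "j < i" by linarith
    then show ?thesis
    proof cases
      case 1 then show ?thesis using less that by blast
    next
      case 2 then show ?thesis using H(2) adj_irrefl[OF G] by simp
    next
      case 3 then show ?thesis using less[OF 3] that adj_commute by metis
    qed
  qed
  moreover have "inj_on (\<lambda>i. [a, b, c, d, e] ! i) {..<5}" using abcde(1) by (intro inj_on_nth) auto
  moreover have "(\<lambda>i. [a, b, c, d, e] ! i) ` {..<5} \<subseteq> verts G" using abcde(2) unfolding lessThan_5 by auto
  ultimately show ?thesis unfolding embeds_def H(1) by simp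
qed

lemma forbidden_irrefl:
  assumes "H \<in> forbidden"
  shows "\<not> adj H i i"
proof (cases "i \<in> verts H")
  case True
  then have "i \<in> {0, 1, 2, 3, 4}" using verts_forbidden[OF assms] lessThan_5 by simp
  with assms show ?thesis
    by (cases rule: forbidden_cases) (auto simp: adj_named)
next
  case False
  with assms show ?thesis
    by (cases rule: forbidden_cases) (auto simp: adj_named)
qed

lemma forbidden_free_if_free_of:
  assumes G: "graph G" and free: "free_of forbidden G"
  shows "forbidden_free (verts G) (adj G)"
proof -
  note adj_irrefl[OF G, simp]
  have V: "u \<in> verts G" "v \<in> verts G" if "adj G u v" for u v
    using that adj_in_verts[OF G] adj_commute by metis+
  have no: False if "H \<in> forbidden" "distinct [a, b, c, d, e]" "{a, b, c, d, e} \<subseteq> verts G"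
      "adj H 0 1 \<longleftrightarrow> adj G a b" "adj H 0 2 \<longleftrightarrow> adj G a c" "adj H 0 3 \<longleftrightarrow> adj G a d" "adj H 0 4 \<longleftrightarrow> adj G a e"
      "adj H 1 2 \<longleftrightarrow> adj G b c" "adj H 1 3 \<longleftrightarrow> adj G b d" "adj H 1 4 \<longleftrightarrow> adj G b e"
      "adj H 2 3 \<longleftrightarrow> adj G c d" "adj H 2 4 \<longleftrightarrow> adj G c e" "adj H 3 4 \<longleftrightarrow> adj G d e" for H a b c d e
    using embeds_nth[OF verts_forbidden[OF that(1)] forbidden_irrefl[OF that(1)] G that(2-)] free that(1)
    unfolding free_of_iff_no_embedding by blast
  show ?thesis
  proof unfold_locales
    show "finite (verts G)" using G unfolding graph_def by blast
  next
    fix u v show "adj G u v \<Longrightarrow> adj G v u" by (simp add: adj_commute)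
  next
    fix u show "\<not> adj G u u" by simp
  next
    fix u v show "adj G u v \<Longrightarrow> u \<in> verts G" using V by blast
  next
    fix a b c d e
    assume h: "adj G a b" "adj G b c" "adj G c d" "adj G d e" "\<not> adj G a c" "\<not> adj G a d"
      "\<not> adj G a e" "\<not> adj G b d" "\<not> adj G b e" "\<not> adj G c e"
    show False
      by (rule no[of "path_graph 5" a b c d e])
        (use h V in \<open>auto simp: forbidden_def adj_named adj_commute\<close>)
  next
    fix a b c d e
    assume h: "adj G a b" "adj G b c" "adj G c d" "adj G d e" "adj G e a" "\<not> adj G a c" "\<not> adj G a d"
      "\<not> adj G b d" "\<not> adj G b e" "\<not> adj G c e"
    show False
      by (rule no[of "cycle_graph 5" a b c d e])
        (use h V in \<open>auto simp: forbidden_def adj_named adj_commute\<close>)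
  next
    fix a b c d e
    assume h: "adj G a b" "adj G a c" "adj G b c" "adj G a d" "adj G b e" "\<not> adj G a e" "\<not> adj G b d"
      "\<not> adj G c d" "\<not> adj G c e" "\<not> adj G d e"
    show False
      by (rule no[of bull a b c d e])
        (use h V in \<open>auto simp: forbidden_def adj_named adj_commute\<close>)
  next
    fix a b c d e
    assume h: "adj G a b" "adj G b c" "adj G c d" "adj G d a" "adj G a e" "\<not> adj G a c" "\<not> adj G b d"
      "\<not> adj G b e" "\<not> adj G c e" "\<not> adj G d e" "b \<noteq> d"
    show False
      by (rule no[of banner a b c d e])
        (use h V in \<open>auto simp: forbidden_def adj_named adj_commute\<close>)
  next
    fix a b c d e
    assume h: "adj G a b" "adj G b c" "adj G c d" "adj G d a" "adj G a e" "adj G b e" "\<not> adj G a c" "\<not> adj G b d"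
      "\<not> adj G c e" "\<not> adj G d e"
    \<comment> \<open>The house is the complement of a path; its non-edges form the path
      \<open>a c e d b\<close>.\<close>
    show False
      by (rule no[of house a c e d b])
        (use h V in \<open>auto simp: forbidden_def adj_named adj_commute\<close>)
  next
    fix a b c d e
    assume h: "adj G a b" "adj G b c" "adj G c d" "adj G d a" "adj G a e" "adj G c e" "\<not> adj G a c" "\<not> adj G b d"
      "\<not> adj G b e" "\<not> adj G d e" "a \<noteq> c" "b \<noteq> d" "b \<noteq> e" "d \<noteq> e"
    show False
      by (rule no[of "complete_bipartite 2 3" a c b d e])
        (use h V in \<open>auto simp: forbidden_def adj_named adj_commute\<close>)
  next
    fix a b c d e
    assume h: "adj G a b" "adj G b c" "adj G c d" "adj G d a" "adj G a e" "adj G b e" "adj G c e"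
      "\<not> adj G a c" "\<not> adj G b d" "\<not> adj G d e" "a \<noteq> c"
    \<comment> \<open>In the complement, \<open>a c\<close> is the \<open>P2\<close> and
      \<open>b d e\<close> is the \<open>P3\<close>.\<close>
    show False
      by (rule no[of "complement P2_union_P3" a c b d e])
        (use h V in \<open>auto simp: forbidden_def adj_named adj_commute\<close>)
  qed
qed

lemma graph_induced: "graph G \<Longrightarrow> W \<subseteq> verts G \<Longrightarrow> W \<noteq> {} \<Longrightarrow> graph (induced_subgraph G W)"
proof -
  assume G: "graph G" and W: "W \<subseteq> verts G" "W \<noteq> {}"
  have "e \<in> all_edges W" if "e \<in> edges G" "e \<subseteq> W" for e
  proof -
    obtain u v where "e = {u, v}" "u \<noteq> v" using G \<open>e \<in> edges G\<close> unfolding graph_def all_edges_def by blast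
    then show ?thesis using \<open>e \<subseteq> W\<close> unfolding all_edges_def by blast
  qed
  moreover have "finite W" using G W finite_subset unfolding graph_def by blast
  ultimately show ?thesis using W unfolding graph_def induced_subgraph_def by auto
qed

text \<open>The axioms of \<open>forbidden_free\<close> restrict from \<open>G\<close> to every
  vertex set, so each induced subgraph is equidominating.\<close>

lemma hereditarily_equidominating_induced:
  assumes G: "graph G" and free: "free_of forbidden G" and W: "W \<subseteq> verts G"
  shows "hereditarily_equidominating (induced_subgraph G W)"
  unfolding hereditarily_equidominating_def
proof (intro allI impI)
  fix W' assume W': "W' \<subseteq> verts (induced_subgraph G W) \<and> W' \<noteq> {}"
  interpret forbidden_free "verts G" "adj G" by (rule forbidden_free_if_free_of[OF G free])
  have "W' \<subseteq> W" "W' \<subseteq> verts G" using W W' by auto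
  moreover have "equidominating (induced_subgraph G W')"
    using forbidden_free_restrict[of W'] calculation W'
    by (intro equidominating_if_forbidden_free) (simp_all add: adj_induced_restrict)
  ultimately show "equidominating (induced_subgraph (induced_subgraph G W) W')"
    by (simp add: induced_induced)
qed

subsection \<open>The three constructions\<close>

text \<open>Cross edges of \<open>G\<close> are edges of \<open>B\<close>, so their ends are
  universal on their sides, and comparability of neighbourhoods in \<open>B\<close> gives the
  exchange condition of \<open>chain_split\<close>.\<close>

lemma chain_joinD:
  assumes "graph G1" "graph G2" and j: "chain_join G1 G2 G"
  shows "chain_split (verts G) (adj G) (verts G1) (verts G2)"
    and "\<And>u v. u \<in> verts G1 \<Longrightarrow> v \<in> verts G1 \<Longrightarrow> adj G u v \<longleftrightarrow> adj G1 u v"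
    and "\<And>u v. u \<in> verts G2 \<Longrightarrow> v \<in> verts G2 \<Longrightarrow> adj G u v \<longleftrightarrow> adj G2 u v"
    and "verts G = verts G1 \<union> verts G2"
proof -
  let ?U1 = "universal_vertices G1" and ?U2 = "universal_vertices G2"
  obtain B where disj: "verts G1 \<inter> verts G2 = {}" and B: "chain_graph B ?U1 ?U2"
    and G: "G = Graph (verts G1 \<union> verts G2) (edges G1 \<union> edges G2 \<union> edges B)"
    using j unfolding chain_join_def by blast
  have U: "?U1 \<subseteq> verts G1" "?U2 \<subseteq> verts G2" unfolding universal_vertices_def by auto
  have adjB: "u \<in> ?U1 \<and> v \<in> ?U2 \<or> u \<in> ?U2 \<and> v \<in> ?U1" if "adj B u v" for u v
  proof -
    have "{u, v} \<in> {{x, y} | x y. x \<in> ?U1 \<and> y \<in> ?U2}"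
      using B that unfolding chain_graph_def adj_def by blast
    then show ?thesis by (auto simp: doubleton_eq_iff)
  qed
  have adjG: "adj G u v \<longleftrightarrow> adj G1 u v \<or> adj G2 u v \<or> adj B u v" for u v
    unfolding G adj_def by simp
  have v1: "u \<in> verts G1" "v \<in> verts G1" if "adj G1 u v" for u v
    using adj_in_verts[OF assms(1)] adj_commute that by metis+
  have v2: "u \<in> verts G2" "v \<in> verts G2" if "adj G2 u v" for u v
    using adj_in_verts[OF assms(2)] adj_commute that by metis+
  show vG: "verts G = verts G1 \<union> verts G2" unfolding G by simp
  show 1: "adj G u v \<longleftrightarrow> adj G1 u v" if "u \<in> verts G1" "v \<in> verts G1" for u v
    using that adjG v2 adjB U disj by blast
  show 2: "adj G u v \<longleftrightarrow> adj G2 u v" if "u \<in> verts G2" "v \<in> verts G2" for u v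
    using that adjG v1 adjB U disj by blast
  have 3: "adj G x y \<longleftrightarrow> adj B x y" if "x \<in> verts G1" "y \<in> verts G2" for x y
    using that adjG v1 v2 disj by blast
  have cross: "x \<in> ?U1" "y \<in> ?U2" if "adj G x y" "x \<in> verts G1" "y \<in> verts G2" for x y
    using adjB[of x y] 3 that U disj by blast+
  have nb: "y \<in> neighbors B x \<longleftrightarrow> adj B x y" for x y
    unfolding neighbors_def adj_def by (simp add: insert_commute)
  show "chain_split (verts G) (adj G) (verts G1) (verts G2)"
    unfolding chain_split_def
  proof (intro conjI ballI impI)
    show "verts G1 \<union> verts G2 = verts G" using vG by simp
    show "verts G1 \<inter> verts G2 = {}" by (rule disj)
    show "verts G1 \<noteq> {}" "verts G2 \<noteq> {}" using assms unfolding graph_def by blast+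
  next
    fix x y u assume xy: "x \<in> verts G1" "y \<in> verts G2" "adj G x y" and u: "u \<in> verts G1 - {x}"
    have "u \<in> neighbors G1 x" using cross[OF xy(3,1,2)] u unfolding universal_vertices_def by blast
    then have "adj G1 x u" unfolding neighbors_def adj_def by (simp add: insert_commute)
    then show "adj G x u" using 1 xy u by blast
  next
    fix x y u assume xy: "x \<in> verts G1" "y \<in> verts G2" "adj G x y" and u: "u \<in> verts G2 - {y}"
    have "u \<in> neighbors G2 y" using cross[OF xy(3,1,2)] u unfolding universal_vertices_def by blast
    then have "adj G2 y u" unfolding neighbors_def adj_def by (simp add: insert_commute)
    then show "adj G y u" using 2 xy u by blast
  next
    fix x x' y y' assume xy: "x \<in> verts G1" "x' \<in> verts G1" "y \<in> verts G2" "y' \<in> verts G2"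
      and a: "adj G x y \<and> adj G x' y'"
    then have "x \<in> ?U1" "x' \<in> ?U1" using cross by blast+
    then have "neighbors B x \<subseteq> neighbors B x' \<or> neighbors B x' \<subseteq> neighbors B x"
      using B unfolding chain_graph_def by blast
    then have "adj B x' y \<or> adj B x y'" using a xy 3 nb by blast
    then show "adj G x y' \<or> adj G x' y" using 3 xy by blast
  qed
qed

text \<open>All cross edges go into \<open>B\<close>. Their ends are universal on their sides by the
  definition of the split, and the exchange condition rules out incomparable neighbourhoods.\<close>

lemma chain_join_if_chain_split:
  assumes G: "graph G" and s: "chain_split (verts G) (adj G) V1 V2"
  shows "chain_join (induced_subgraph G V1) (induced_subgraph G V2) G"
proof -
  let ?G1 = "induced_subgraph G V1" and ?G2 = "induced_subgraph G V2"
  let ?U1 = "universal_vertices ?G1" and ?U2 = "universal_vertices ?G2"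
  note V = chain_splitD(1-4)[OF s] and full = chain_splitD(5,6)[OF s] and chain = chain_splitD(7)[OF s]
  have U: "v \<in> universal_vertices (induced_subgraph G W) \<longleftrightarrow> v \<in> W \<and> (\<forall>u\<in>W - {v}. adj G v u)" for v W
    unfolding universal_vertices_def neighbors_def adj_def[symmetric] by (auto simp: adj_commute)
  define B where "B = Graph (?U1 \<union> ?U2) {{x, y} | x y. x \<in> V1 \<and> y \<in> V2 \<and> adj G x y}"
  have nb: "u \<in> neighbors B v \<longleftrightarrow> adj G v u \<and> (v \<in> V1 \<and> u \<in> V2 \<or> v \<in> V2 \<and> u \<in> V1)" for u v
  proof -
    have "u \<in> neighbors B v \<longleftrightarrow>
        (\<exists>x y. (u = x \<and> v = y \<or> u = y \<and> v = x) \<and> x \<in> V1 \<and> y \<in> V2 \<and> adj G x y)"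
      unfolding neighbors_def B_def by (simp add: doubleton_eq_iff)
    then show ?thesis using adj_commute[of G u v] by blast
  qed
  have "chain_graph B ?U1 ?U2"
    unfolding chain_graph_def
  proof (intro conjI ballI)
    show "?U1 \<inter> ?U2 = {}" using V U by blast
    show "verts B = ?U1 \<union> ?U2" unfolding B_def by simp
    have "x \<in> ?U1 \<and> y \<in> ?U2" if "x \<in> V1" "y \<in> V2" "adj G x y" for x y
      using full that unfolding U by blast
    then show "edges B \<subseteq> {{x, y} | x y. x \<in> ?U1 \<and> y \<in> ?U2}" unfolding B_def graph.sel by blast
  next
    fix x x' assume "x \<in> ?U1" "x' \<in> ?U1"
    then have "x \<in> V1" "x' \<in> V1" using U by blast+
    then have "\<not> (\<exists>y y'. y \<in> neighbors B x \<and> y \<notin> neighbors B x' \<and> y' \<in> neighbors B x' \<and> y' \<notin> neighbors B x)"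
      using chain V(2) unfolding nb by blast
    then show "neighbors B x \<subseteq> neighbors B x' \<or> neighbors B x' \<subseteq> neighbors B x" by blast
  next
    fix y y' assume "y \<in> ?U2" "y' \<in> ?U2"
    then have y: "y \<in> V2" "y' \<in> V2" using U by blast+
    have "x' \<in> neighbors B y \<or> x \<in> neighbors B y'" if x: "x \<in> neighbors B y" "x' \<in> neighbors B y'" for x x'
    proof -
      have "x \<in> V1" "x' \<in> V1" "adj G x y" "adj G x' y'"
        using x y V(2) unfolding nb adj_commute[of G y] adj_commute[of G y'] by blast+
      then have "adj G x y' \<or> adj G x' y" using chain y by blast
      then show ?thesis
        using \<open>x \<in> V1\<close> \<open>x' \<in> V1\<close> y unfolding nb adj_commute[of G y] adj_commute[of G y'] by blast
    qed
    then show "neighbors B y \<subseteq> neighbors B y' \<or> neighbors B y' \<subseteq> neighbors B y" by blast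
  qed
  moreover have "edges G = edges ?G1 \<union> edges ?G2 \<union> edges B"
  proof (intro set_eqI iffI)
    fix e assume e: "e \<in> edges G"
    then obtain u v where uv: "e = {u, v}" "u \<in> verts G" "v \<in> verts G"
      using G unfolding graph_def all_edges_def by blast
    have a: "adj G u v" "adj G v u" using e uv unfolding adj_def by (simp_all add: insert_commute)
    have "u \<in> V1 \<and> v \<in> V1 \<or> u \<in> V2 \<and> v \<in> V2 \<or> u \<in> V1 \<and> v \<in> V2 \<or> v \<in> V1 \<and> u \<in> V2"
      using uv V by blast
    then show "e \<in> edges ?G1 \<union> edges ?G2 \<union> edges B"
      using e uv(1) a unfolding B_def induced_subgraph_def by (auto simp: insert_commute)
  next
    fix e assume "e \<in> edges ?G1 \<union> edges ?G2 \<union> edges B"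
    then show "e \<in> edges G" unfolding B_def induced_subgraph_def adj_def by auto
  qed
  then have "G = Graph (verts ?G1 \<union> verts ?G2) (edges ?G1 \<union> edges ?G2 \<union> edges B)"
    using V by (simp add: graph.expand)
  ultimately show ?thesis using V unfolding chain_join_def verts_induced by blast
qed

text \<open>A forbidden copy meeting both sides would inherit a chain split from them; a copy inside
  one side contradicts the freeness of that side.\<close>

lemma free_of_chain_join:
  assumes "graph G1" "graph G2" and j: "chain_join G1 G2 G"
    and free: "free_of forbidden G1" "free_of forbidden G2"
  shows "free_of forbidden G"
  unfolding free_of_iff_no_embedding
proof (rule notI, elim bexE exE)
  fix H g assume H: "H \<in> forbidden" and g: "embeds H G g"
  note cj = chain_joinD[OF assms(1,2) j]
  have adj: "adj G (g i) (g k) \<longleftrightarrow> adj H i k" if "i \<in> verts H" "k \<in> verts H" for i k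
    using g that unfolding embeds_def by blast
  have inj: "g i = g k \<longleftrightarrow> i = k" if "i \<in> verts H" "k \<in> verts H" for i k
    using g that unfolding embeds_def inj_on_def by blast
  have gV: "g i \<in> verts G1 \<or> g i \<in> verts G2" if "i \<in> verts H" for i
    using g that cj(4) unfolding embeds_def by blast
  have n1: "\<not> g ` verts H \<subseteq> verts G1"
  proof
    assume "g ` verts H \<subseteq> verts G1"
    then have "embeds H G1 g" using g cj(2) unfolding embeds_def by (simp add: image_subset_iff)
    then show False using free(1) H unfolding free_of_iff_no_embedding by blast
  qed
  have n2: "\<not> g ` verts H \<subseteq> verts G2"
  proof
    assume "g ` verts H \<subseteq> verts G2"
    then have "embeds H G2 g" using g cj(3) unfolding embeds_def by (simp add: image_subset_iff)
    then show False using free(2) H unfolding free_of_iff_no_embedding by blast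
  qed
  note V = chain_splitD(2)[OF cj(1)] and full = chain_splitD(5,6)[OF cj(1)] and chain = chain_splitD(7)[OF cj(1)]
  let ?V1 = "{i \<in> verts H. g i \<in> verts G1}" and ?V2 = "{i \<in> verts H. g i \<in> verts G2}"
  have "chain_split (verts H) (adj H) ?V1 ?V2"
    unfolding chain_split_def
  proof (intro conjI ballI impI)
    show "?V1 \<union> ?V2 = verts H" using gV by blast
    show "?V1 \<inter> ?V2 = {}" using V by blast
    show "?V1 \<noteq> {}" using n2 gV by blast
    show "?V2 \<noteq> {}" using n1 gV by blast
  next
    fix x y u assume "x \<in> ?V1" "y \<in> ?V2" "adj H x y" "u \<in> ?V1 - {x}"
    then show "adj H x u" using full(1)[of "g x" "g y" "g u"] adj inj by simp
  next
    fix x y u assume "x \<in> ?V1" "y \<in> ?V2" "adj H x y" "u \<in> ?V2 - {y}"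
    then show "adj H y u" using full(2)[of "g x" "g y" "g u"] adj inj by simp
  next
    fix x x' y y' assume "x \<in> ?V1" "x' \<in> ?V1" "y \<in> ?V2" "y' \<in> ?V2" "adj H x y \<and> adj H x' y'"
    then show "adj H x y' \<or> adj H x' y" using chain[of "g x" "g x'" "g y" "g y'"] adj by simp
  qed
  then show False using forbidden_no_chain_split[OF H] by blast
qed

text \<open>The new vertex would be universal in any forbidden copy containing it, so every copy
  lies in \<open>H\<close>.\<close>

lemma free_of_add_universal:
  assumes "v \<notin> verts H" "graph H" and free: "free_of forbidden H"
  shows "free_of forbidden (add_universal v H)"
  unfolding free_of_iff_no_embedding
proof (rule notI, elim bexE exE)
  let ?G = "add_universal v H"
  fix F g assume F: "F \<in> forbidden" and g: "embeds F ?G g"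
  have adjG: "adj ?G x y \<longleftrightarrow> adj H x y \<or> x \<in> verts H \<and> y = v \<or> y \<in> verts H \<and> x = v" for x y
    unfolding add_universal_def adj_def by (auto simp: doubleton_eq_iff)
  have vG: "verts ?G = insert v (verts H)" unfolding add_universal_def by simp
  have gV: "g i \<in> insert v (verts H)" if "i \<in> verts F" for i
    using g that unfolding embeds_def vG by blast
  have adj: "adj F i k \<longleftrightarrow> adj ?G (g i) (g k)" if "i \<in> verts F" "k \<in> verts F" for i k
    using g that unfolding embeds_def by blast
  have "g c \<noteq> v" if c: "c \<in> verts F" for c
  proof
    assume gc: "g c = v"
    obtain k where k: "k \<in> verts F" "k \<noteq> c" "\<not> adj F c k" using forbidden_no_universal[OF F] c by blast
    then have "g k \<noteq> v" using g c gc unfolding embeds_def inj_on_def by metis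
    then show False using k adj[OF c k(1)] adjG gV[OF k(1)] gc by blast
  qed
  then have "g ` verts F \<subseteq> verts H" "\<And>i. i \<in> verts F \<Longrightarrow> g i \<noteq> v" using gV by blast+
  then have "embeds F H g" using g adjG unfolding embeds_def by simp
  then show False using free F unfolding free_of_iff_no_embedding by blast
qed

text \<open>The removed pairs are the fibres of \<open>div 2\<close>, which is the form that
  \<open>cocktail_party_bij\<close> delivers.\<close>

lemma adj_complete_minus_matching:
  "adj (complete_minus_matching n) i j \<longleftrightarrow> i < 2 * n \<and> j < 2 * n \<and> i div 2 \<noteq> j div 2"
proof -
  have "(\<exists>k<n. i = 2 * k \<and> j = 2 * k + 1 \<or> j = 2 * k \<and> i = 2 * k + 1) \<longleftrightarrow> i \<noteq> j \<and> i div 2 = j div 2"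
    if "i < 2 * n" "j < 2 * n"
  proof
    assume r: "i \<noteq> j \<and> i div 2 = j div 2"
    then have "i = 2 * (i div 2) \<and> j = 2 * (i div 2) + 1 \<or> j = 2 * (i div 2) \<and> i = 2 * (i div 2) + 1"
      by presburger
    then show "\<exists>k<n. i = 2 * k \<and> j = 2 * k + 1 \<or> j = 2 * k \<and> i = 2 * k + 1"
      using that by (intro exI[of _ "i div 2"]) auto
  qed auto
  then show ?thesis
    unfolding complete_minus_matching_def adj_def all_edges_def
    by (auto simp: doubleton_eq_iff)
qed

text \<open>In \<open>complete_minus_matching\<close>, a vertex with two non-neighbours would give
  three distinct numbers with the same quotient by 2.\<close>

lemma free_of_basic:
  assumes G: "graph G" and b: "basic G"
  shows "free_of forbidden G"
  unfolding free_of_iff_no_embedding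
proof (rule notI, elim bexE exE)
  fix H g assume H: "H \<in> forbidden" and g: "embeds H G g"
  obtain i j k where ijk: "i \<in> verts H" "j \<in> verts H" "k \<in> verts H" "i \<noteq> j" "i \<noteq> k" "j \<noteq> k"
    "\<not> adj H i j" "\<not> adj H i k"
    using forbidden_two_nonneighbors[OF H] by blast
  then have G3: "g i \<in> verts G" "g j \<in> verts G" "g k \<in> verts G" "g i \<noteq> g j" "g i \<noteq> g k" "g j \<noteq> g k"
    "\<not> adj G (g i) (g j)" "\<not> adj G (g i) (g k)"
    using g unfolding embeds_def inj_on_def by blast+
  from b show False unfolding basic_def
  proof (elim disjE exE conjE)
    assume "isomorphic G (complete_graph 1)"
    then obtain f where "bij_betw f (verts G) {..<1::nat}"
      unfolding isomorphic_def complete_graph_def by auto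
    then have "f (g i) < 1" "f (g j) < 1" "inj_on f (verts G)" using G3 unfolding bij_betw_def by blast+
    then show False using G3 unfolding inj_on_def by (metis less_one)
  next
    fix n assume "isomorphic G (complete_minus_matching n)"
    then obtain f where f: "bij_betw f (verts G) {..<2 * n}"
      and adj: "\<And>u v. u \<in> verts G \<Longrightarrow> v \<in> verts G \<Longrightarrow> adj G u v \<longleftrightarrow> adj (complete_minus_matching n) (f u) (f v)"
      unfolding isomorphic_def adj_def complete_minus_matching_def by auto
    have "f (g i) div 2 = f (g j) div 2" "f (g i) div 2 = f (g k) div 2"
      using adj[of "g i" "g j"] adj[of "g i" "g k"] G3 f unfolding adj_complete_minus_matching bij_betw_def by auto
    moreover have "f (g i) \<noteq> f (g j)" "f (g i) \<noteq> f (g k)" "f (g j) \<noteq> f (g k)"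
      using G3 f unfolding bij_betw_def inj_on_def by blast+
    moreover have "x = 2 * (x div 2) \<or> x = 2 * (x div 2) + 1" for x :: nat by presburger
    ultimately show False by metis
  qed
qed

lemma basic_if_cocktail_party:
  assumes G: "graph G" and cp: "cocktail_party (verts G) (adj G)" and card: "3 \<le> card (verts G)"
  shows "basic G"
proof -
  have "finite (verts G)" using G unfolding graph_def by blast
  then obtain n f where f: "bij_betw f (verts G) {..<2 * n::nat}"
    and adj: "\<forall>u\<in>verts G. \<forall>v\<in>verts G. u \<noteq> v \<longrightarrow> (adj G u v \<longleftrightarrow> f u div 2 \<noteq> f v div 2)"
    using cocktail_party_bij[OF _ cp] adj_commute by metis
  have "adj G u v \<longleftrightarrow> adj (complete_minus_matching n) (f u) (f v)" if "u \<in> verts G" "v \<in> verts G" for u v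
  proof (cases "u = v")
    case True then show ?thesis using adj_irrefl[OF G] by (simp add: adj_complete_minus_matching)
  next
    case False then show ?thesis using adj that f unfolding adj_complete_minus_matching bij_betw_def by auto
  qed
  then have "isomorphic G (complete_minus_matching n)"
    using f unfolding isomorphic_def adj_def complete_minus_matching_def by auto
  moreover have "n \<ge> 2" using bij_betw_same_card[OF f] card by simp
  ultimately show ?thesis unfolding basic_def by blast
qed

lemma basic_singleton:
  assumes G: "graph G" and v: "verts G = {v}"
  shows "basic G"
proof -
  have "edges G = {}" using G v unfolding graph_def all_edges_def by auto
  moreover have "edges (complete_graph 1) = {}" unfolding complete_graph_def all_edges_def by auto
  moreover have "bij_betw (\<lambda>_. 0) (verts G) (verts (complete_graph 1))"
    unfolding v complete_graph_def by (auto simp: bij_betw_def)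
  ultimately show ?thesis unfolding basic_def isomorphic_def by auto
qed

text \<open>From (b) to (c), the parts are hereditarily equidominating as induced subgraphs of a
  forbidden-free graph; from (c) to (b), the implication from (a) to (b) first makes the parts
  forbidden-free.\<close>

theorem theorem8p1:
  fixes G :: "'a graph"
  assumes "graph G"
  shows "(hereditarily_equidominating G \<longleftrightarrow> free_of forbidden G) \<and>
         (free_of forbidden G \<longleftrightarrow>
            basic G \<or>
            (\<exists>H v. graph H \<and> hereditarily_equidominating H \<and> v \<notin> verts H \<and>
                   G = add_universal v H) \<or>
            (\<exists>G1 G2. graph G1 \<and> graph G2 \<and>
                     hereditarily_equidominating G1 \<and> hereditarily_equidominating G2 \<and>
                     chain_join G1 G2 G))" (is "(?a \<longleftrightarrow> ?b) \<and> (?b \<longleftrightarrow> ?i \<or> ?ii \<or> ?iii)")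
proof -
  have ba: ?a if ?b
  proof -
    have "induced_subgraph G (verts G) = G"
      using assms unfolding graph_def induced_subgraph_def all_edges_def
      by (intro graph.expand) auto
    then show ?a using hereditarily_equidominating_induced[OF assms that subset_refl] by simp
  qed
  have bc: "?i \<or> ?ii \<or> ?iii" if b: ?b
  proof (cases "\<exists>v\<in>verts G. \<forall>u\<in>verts G. u \<noteq> v \<longrightarrow> adj G v u")
    case True
    then obtain v where v: "v \<in> verts G" "\<And>u. u \<in> verts G \<Longrightarrow> u \<noteq> v \<Longrightarrow> adj G v u" by blast
    let ?W = "verts G - {v}"
    show ?thesis
    \<comment> \<open>A lone universal vertex is \<open>K_1\<close> and hence basic; otherwise the
      rest is nonempty and counts as a \<open>graph\<close>.\<close>
    proof (cases "?W = {}")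
      case True
      then show ?thesis using basic_singleton[OF assms, of v] v by blast
    next
      case False
      let ?H = "induced_subgraph G ?W"
      have "edges G = edges ?H \<union> {{u, v} | u. u \<in> verts ?H}"
      proof (intro set_eqI iffI)
        fix e assume e: "e \<in> edges G"
        then obtain x y where "e = {x, y}" "x \<in> verts G" "y \<in> verts G" "x \<noteq> y"
          using assms unfolding graph_def all_edges_def by blast
        then show "e \<in> edges ?H \<union> {{u, v} | u. u \<in> verts ?H}"
          using e unfolding induced_subgraph_def by (auto simp: insert_commute)
      next
        fix e assume "e \<in> edges ?H \<union> {{u, v} | u. u \<in> verts ?H}"
        then show "e \<in> edges G" using v unfolding induced_subgraph_def adj_def by (auto simp: insert_commute)
      qed
      then have "G = add_universal v ?H"
        using v unfolding add_universal_def by (intro graph.expand) auto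
      moreover have "graph ?H" using graph_induced[OF assms _ False] by blast
      moreover have "hereditarily_equidominating ?H"
        by (rule hereditarily_equidominating_induced[OF assms b]) blast
      moreover have "v \<notin> verts ?H" by simp
      ultimately show ?thesis by blast
    qed
  next
    case False
    interpret forbidden_free "verts G" "adj G" by (rule forbidden_free_if_free_of[OF assms b])
    have "cocktail_party (verts G) (adj G) \<and> 3 \<le> card (verts G) \<or> (\<exists>V1 V2. chain_split (verts G) (adj G) V1 V2)"
      by (rule cocktail_party_or_chain_split) (use assms False in \<open>auto simp: graph_def\<close>)
    then show ?thesis
    proof (elim disjE exE)
      fix V1 V2 assume s: "chain_split (verts G) (adj G) V1 V2"
      then have V: "V1 \<subseteq> verts G" "V2 \<subseteq> verts G" "V1 \<noteq> {}" "V2 \<noteq> {}" unfolding chain_split_def by auto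
      then show ?thesis
        using chain_join_if_chain_split[OF assms s] graph_induced[OF assms]
          hereditarily_equidominating_induced[OF assms b] by metis
    qed (use basic_if_cocktail_party[OF assms] in blast)
  qed
  have "?b" if "?i \<or> ?ii \<or> ?iii"
    using that
  proof (elim disjE exE conjE)
    assume ?i then show ?b by (rule free_of_basic[OF assms])
  next
    fix H v assume "graph H" "hereditarily_equidominating H" "v \<notin> verts H" "G = add_universal v H"
    then show ?b using free_of_add_universal hereditarily_equidominating_imp_free by metis
  next
    fix G1 G2 assume "graph G1" "graph G2" "hereditarily_equidominating G1" "hereditarily_equidominating G2"
      "chain_join G1 G2 G"
    then show ?b using free_of_chain_join hereditarily_equidominating_imp_free by metis
  qed
  then show ?thesis using ba bc hereditarily_equidominating_imp_free by blast
qed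

end
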